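(* Let $G$ be a finite group, $p$ a prime, and let $\mathscr D:(G\text{-}\mathrm{sets})^{\mathrm{op}}\to\mathrm{Add}$ be a strict stack on $G\text{-}\mathrm{sets}$ for the sipp topology. Let $H\leq G$ be a subgroup of index prime to $p$ and let $\alpha:G/H\twoheadrightarrow G/G$ be the associated $G$-map. Then: (a) Let $V,V'\in\mathscr D(G/G)$. Then $f_0\mapsto\alpha^*(f_0)$ defines a bijection between the morphisms $f_0:V\to V'$ in $\mathscr D(G/G)$ and those morphisms $f:\alpha^*V\to\alpha^*V'$ in $\mathscr D(G/H)$ such that $\beta_1^*(f)=\beta_g^*(f)$ in $\mathscr D(G/H[g])$ for every $g\in G$, where $\beta_1,\beta_g:G/H[g]\to G/H$. (b) Suppose given an object $W\in\mathscr D(G/H)$ and isomorphisms $s_g:\beta_1^*W\overset{\sim}{\to}\beta_g^*W$ in $\mathscr D(G/H[g])$ for every $g\in G$, for the $G$-maps $\beta_1,\beta_g:G/H[g]\to G/H$, satisfying: (i) For every $h\in H$ (in which case $H[h]=H$, $\beta_1=\beta_h=\mathrm{id}_{G/H}$ and therefore $\beta_1^*W=W=\beta_h^*W$), $s_h=\mathrm{id}_W$ in $\mathscr D(G/H)$. (ii) For all $g_1,g_2\in G$, the equality $\beta_1^*(s_{g_2g_1})=\beta_{g_1}^*(s_{g_2})\circ\beta_1^*(s_{g_1})$ holds in $\mathscr D(G/H[g_2,g_1])$, for $\beta_1:G/H[g_2,g_1]\to G/H[g_2g_1]$, $\beta_{g_1}:G/H[g_2,g_1]\to G/H[g_2]$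 and $\beta_1:G/H[g_2,g_1]\to G/H[g_1]$ respectively. Then there exists an object $V\in\mathscr D(G/G)$ and an isomorphism $f:\alpha^*V\overset{\sim}{\to}W$ in $\mathscr D(G/H)$ such that $\beta_g^*(f)=s_g\circ\beta_1^*(f)$ in $\mathscr D(G/H[g])$ for every $g\in G$. Moreover, the pair $(V,f)$ is unique up to unique isomorphism of such pairs.
   Context: $G\text{-}\mathrm{sets}$ is the category of finite left $G$-sets and $G$-equivariant maps ($G$-maps); $\mathrm{Add}$ is the category of additive categories; $\mathscr D$ is a strict contravariant functor and $\alpha^*:=\mathscr D(\alpha)$ for every $G$-map $\alpha$. Notation: $H^g=g^{-1}Hg$, $H[g]=H^g\cap H$, $H[g_2,g_1]=H^{g_2g_1}\cap H^{g_1}\cap H$. For subgroups $K,L\leq G$ and $g\in G$ with $gKg^{-1}\leq L$, $\beta_g:G/K\to G/L$ is the $G$-map $[x]_K\mapsto[xg^{-1}]_L$ (so $\beta_1$ is the projection when $K\leq L$). A $G$-map $\alpha:U\to X$ is a sipp-cover if every $x\in X$ has a preimage $u\in\alpha^{-1}(x)$ such that the index $[\mathrm{St}_G(x):\mathrm{St}_G(u)]$ of stabilizers is prime to $p$. For such a cover let $U^{(2)}=U\times_XU$ and $U^{(3)}=U\times_XU\times_XU$, with projections $\mathrm{pr}_i:U^{(2)}\to U$ and $\mathrm{pr}_{ij}:U^{(3)}\to U^{(2)}$. The descent category $\mathrm{Desc}_{\mathscr D}(U\to X)$ has as objects pairs $(W,s)$ with $W\in\mathscr D(U)$ and $s:\mathrm{pr}_2^*W\overset{\sim}{\to}\mathrm{pr}_1^*W$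 an isomorphism in $\mathscr D(U^{(2)})$ such that $\mathrm{pr}_{13}^*(s)=\mathrm{pr}_{12}^*(s)\circ\mathrm{pr}_{23}^*(s)$ in $\mathscr D(U^{(3)})$; morphisms $(W,s)\to(W',s')$ are morphisms $f:W\to W'$ in $\mathscr D(U)$ with $\mathrm{pr}_1^*(f)\circ s=s'\circ\mathrm{pr}_2^*(f)$. $\mathscr D$ is a strict stack for the sipp topology if for every finite $G$-set $X$ and every sipp-cover $\alpha:U\to X$ the functor $\mathscr D(X)\to\mathrm{Desc}_{\mathscr D}(U\to X)$, $V\mapsto(\alpha^*V,\mathrm{id})$, $f\mapsto\alpha^*(f)$, is an equivalence of categories. Examples of such $\mathscr D$: let $G\ltimes X$ be the action groupoid of $X$ (objects the elements of $X$, morphisms $x\to x'$ the $g\in G$ with $gx=x'$) and $\mathrm{Rep}(X)$ the category of functors from $G\ltimes X$ to an idempotent-complete additive category $\mathscr A$ over $\mathbb Z_{(p)}$; one may take $\mathscr D(X)=\mathrm{Rep}(X)$, or its derived category if $\mathscr A$ is abelian, or its stable category (additive quotient by projectives) if $\mathscr A$ is the category of vector spaces over a field of characteristic $p$.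
   Formalization: The formal theorem also assumes that D turns disjoint unions into products, D(X1⊔X2) ≃ D(X1)×D(X2); with descent along single sipp-covers only, the claim fails, e.g. for D constant with value Q-vector spaces, G=Z/2, H=1, p=3, s_g the sign. *)

theory Defs
  imports "HOL-Algebra.Group_Action" "HOL-Algebra.Left_Coset" "HOL-Computational_Algebra.Primes"
begin

section \<open>Categories, functors, equivalences\<close>

text \<open>Arrows carry their domain and codomain. Only the values of the operations on objects and
  arrows (resp. composable arrows) of the category matter.\<close>

record ('o, 'm) cat =
  Ob :: "'o set"
  Arr :: "'m set"
  Dom :: "'m \<Rightarrow> 'o"
  Cod :: "'m \<Rightarrow> 'o"
  Idn :: "'o \<Rightarrow> 'm"
  Cmp :: "'m \<Rightarrow> 'm \<Rightarrow> 'm"  (infixr \<open>\<cdot>\<index>\<close> 70)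

definition arrows :: "('o, 'm, 'z) cat_scheme \<Rightarrow> 'o \<Rightarrow> 'o \<Rightarrow> 'm set" where
  "arrows C A B = {f \<in> Arr C. Dom C f = A \<and> Cod C f = B}"

definition category :: "('o, 'm, 'z) cat_scheme \<Rightarrow> bool" where
  "category C \<longleftrightarrow>
     (\<forall>f\<in>Arr C. Dom C f \<in> Ob C \<and> Cod C f \<in> Ob C) \<and>
     (\<forall>A\<in>Ob C. Idn C A \<in> arrows C A A) \<and>
     (\<forall>f\<in>Arr C. \<forall>g\<in>Arr C. Dom C g = Cod C f \<longrightarrow>
        g \<cdot>\<^bsub>C\<^esub> f \<in> arrows C (Dom C f) (Cod C g)) \<and>
     (\<forall>f\<in>Arr C. f \<cdot>\<^bsub>C\<^esub> Idn C (Dom C f) = f \<and> Idn C (Cod C f) \<cdot>\<^bsub>C\<^esub> f = f) \<and>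
     (\<forall>f\<in>Arr C. \<forall>g\<in>Arr C. \<forall>h\<in>Arr C. Dom C g = Cod C f \<longrightarrow> Dom C h = Cod C g \<longrightarrow>
        (h \<cdot>\<^bsub>C\<^esub> g) \<cdot>\<^bsub>C\<^esub> f = h \<cdot>\<^bsub>C\<^esub> (g \<cdot>\<^bsub>C\<^esub> f))"

definition iso_arrow :: "('o, 'm, 'z) cat_scheme \<Rightarrow> 'o \<Rightarrow> 'o \<Rightarrow> 'm \<Rightarrow> bool" where
  "iso_arrow C A B f \<longleftrightarrow> f \<in> arrows C A B \<and>
     (\<exists>g\<in>arrows C B A. g \<cdot>\<^bsub>C\<^esub> f = Idn C A \<and> f \<cdot>\<^bsub>C\<^esub> g = Idn C B)"

record ('o, 'm, 'p, 'n) ftor =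
  omap :: "'o \<Rightarrow> 'p"
  amap :: "'m \<Rightarrow> 'n"

definition is_functor ::
  "('o, 'm, 'y) cat_scheme \<Rightarrow> ('p, 'n, 'z) cat_scheme \<Rightarrow> ('o, 'm, 'p, 'n) ftor \<Rightarrow> bool" where
  "is_functor C E F \<longleftrightarrow> category C \<and> category E \<and>
     (\<forall>A\<in>Ob C. omap F A \<in> Ob E) \<and>
     (\<forall>f\<in>Arr C. amap F f \<in> arrows E (omap F (Dom C f)) (omap F (Cod C f))) \<and>
     (\<forall>A\<in>Ob C. amap F (Idn C A) = Idn E (omap F A)) \<and>
     (\<forall>f\<in>Arr C. \<forall>g\<in>Arr C. Dom C g = Cod C f \<longrightarrow>
        amap F (g \<cdot>\<^bsub>C\<^esub> f) = amap F g \<cdot>\<^bsub>E\<^esub> amap F f)"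

definition id_ftor :: "('o, 'm, 'o, 'm) ftor" where
  "id_ftor = \<lparr>omap = \<lambda>A. A, amap = \<lambda>f. f\<rparr>"

definition comp_ftor ::
  "('p, 'n, 'q, 'k) ftor \<Rightarrow> ('o, 'm, 'p, 'n) ftor \<Rightarrow> ('o, 'm, 'q, 'k) ftor" where
  "comp_ftor F' F = \<lparr>omap = \<lambda>A. omap F' (omap F A), amap = \<lambda>f. amap F' (amap F f)\<rparr>"

definition natural_iso ::
  "('o, 'm, 'y) cat_scheme \<Rightarrow> ('p, 'n, 'z) cat_scheme \<Rightarrow>
   ('o, 'm, 'p, 'n) ftor \<Rightarrow> ('o, 'm, 'p, 'n) ftor \<Rightarrow> ('o \<Rightarrow> 'n) \<Rightarrow> bool" where
  "natural_iso C E F F' t \<longleftrightarrow>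
     (\<forall>A\<in>Ob C. iso_arrow E (omap F A) (omap F' A) (t A)) \<and>
     (\<forall>f\<in>Arr C. t (Cod C f) \<cdot>\<^bsub>E\<^esub> amap F f = amap F' f \<cdot>\<^bsub>E\<^esub> t (Dom C f))"

definition equivalence_functor ::
  "('o, 'm, 'y) cat_scheme \<Rightarrow> ('p, 'n, 'z) cat_scheme \<Rightarrow> ('o, 'm, 'p, 'n) ftor \<Rightarrow> bool" where
  "equivalence_functor C E F \<longleftrightarrow> is_functor C E F \<and>
     (\<exists>F' t u. is_functor E C F' \<and>
        natural_iso C C id_ftor (comp_ftor F' F) t \<and>
        natural_iso E E (comp_ftor F F') id_ftor u)"

definition prod_cat ::
  "('o, 'm, 'y) cat_scheme \<Rightarrow> ('p, 'n, 'z) cat_scheme \<Rightarrow> ('o \<times> 'p, 'm \<times> 'n) cat" where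
  "prod_cat C E =
     \<lparr>Ob = Ob C \<times> Ob E, Arr = Arr C \<times> Arr E,
      Dom = \<lambda>(f, g). (Dom C f, Dom E g), Cod = \<lambda>(f, g). (Cod C f, Cod E g),
      Idn = \<lambda>(A, B). (Idn C A, Idn E B),
      Cmp = \<lambda>(f', g') (f, g). (f' \<cdot>\<^bsub>C\<^esub> f, g' \<cdot>\<^bsub>E\<^esub> g)\<rparr>"


section \<open>Additive categories\<close>

record ('o, 'm) addcat = "('o, 'm) cat" +
  Plus :: "'m \<Rightarrow> 'm \<Rightarrow> 'm"  (infixl \<open>\<boxplus>\<index>\<close> 65)
  Zero :: "'o \<Rightarrow> 'o \<Rightarrow> 'm"

definition preadditive :: "('o, 'm, 'z) addcat_scheme \<Rightarrow> bool" where
  "preadditive C \<longleftrightarrow> category C \<and>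
     (\<forall>A\<in>Ob C. \<forall>B\<in>Ob C.
        comm_group \<lparr>carrier = arrows C A B, monoid.mult = Plus C, one = Zero C A B\<rparr>) \<and>
     (\<forall>A\<in>Ob C. \<forall>B\<in>Ob C. \<forall>E\<in>Ob C.
        \<forall>f\<in>arrows C A B. \<forall>f'\<in>arrows C A B. \<forall>g\<in>arrows C B E. \<forall>g'\<in>arrows C B E.
          g \<cdot>\<^bsub>C\<^esub> (f \<boxplus>\<^bsub>C\<^esub> f') = (g \<cdot>\<^bsub>C\<^esub> f) \<boxplus>\<^bsub>C\<^esub> (g \<cdot>\<^bsub>C\<^esub> f') \<and>
          (g \<boxplus>\<^bsub>C\<^esub> g') \<cdot>\<^bsub>C\<^esub> f = (g \<cdot>\<^bsub>C\<^esub> f) \<boxplus>\<^bsub>C\<^esub> (g' \<cdot>\<^bsub>C\<^esub> f))"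

definition zero_object :: "('o, 'm, 'z) addcat_scheme \<Rightarrow> 'o \<Rightarrow> bool" where
  "zero_object C N \<longleftrightarrow> N \<in> Ob C \<and>
     (\<forall>A\<in>Ob C. (\<exists>!f. f \<in> arrows C A N) \<and> (\<exists>!f. f \<in> arrows C N A))"

definition biproduct ::
  "('o, 'm, 'z) addcat_scheme \<Rightarrow> 'o \<Rightarrow> 'o \<Rightarrow> 'o \<Rightarrow> 'm \<Rightarrow> 'm \<Rightarrow> 'm \<Rightarrow> 'm \<Rightarrow> bool" where
  "biproduct C A B P i j q r \<longleftrightarrow> P \<in> Ob C \<and>
     i \<in> arrows C A P \<and> j \<in> arrows C B P \<and> q \<in> arrows C P A \<and> r \<in> arrows C P B \<and>
     q \<cdot>\<^bsub>C\<^esub> i = Idn C A \<and> r \<cdot>\<^bsub>C\<^esub> j = Idn C B \<and>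
     q \<cdot>\<^bsub>C\<^esub> j = Zero C B A \<and> r \<cdot>\<^bsub>C\<^esub> i = Zero C A B \<and>
     (i \<cdot>\<^bsub>C\<^esub> q) \<boxplus>\<^bsub>C\<^esub> (j \<cdot>\<^bsub>C\<^esub> r) = Idn C P"

definition additive_category :: "('o, 'm, 'z) addcat_scheme \<Rightarrow> bool" where
  "additive_category C \<longleftrightarrow> preadditive C \<and> (\<exists>N. zero_object C N) \<and>
     (\<forall>A\<in>Ob C. \<forall>B\<in>Ob C. \<exists>P i j q r. biproduct C A B P i j q r)"

definition additive_functor ::
  "('o, 'm, 'y) addcat_scheme \<Rightarrow> ('p, 'n, 'z) addcat_scheme \<Rightarrow> ('o, 'm, 'p, 'n) ftor \<Rightarrow> bool"
where
  "additive_functor C E F \<longleftrightarrow> is_functor C E F \<and>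
     (\<forall>A\<in>Ob C. \<forall>B\<in>Ob C. \<forall>f\<in>arrows C A B. \<forall>f'\<in>arrows C A B.
        amap F (f \<boxplus>\<^bsub>C\<^esub> f') = amap F f \<boxplus>\<^bsub>E\<^esub> amap F f')"


section \<open>Finite G-sets\<close>

text \<open>The elements of G-sets come from a universe that contains arbitrary atoms and all cosets and
  is closed under ordered pairs. It is infinite, so every finite G-set has an isomorphic copy in it,
  and coset spaces and fibre products can be formed literally in it.\<close>

datatype ('g, 'a) point =
    Atom 'a
  | Coset "'g set"
  | Pt_Pair "('g, 'a) point" "('g, 'a) point"

record ('g, 'a) gset =
  Pts :: "('g, 'a) point set"
  Act :: "'g \<Rightarrow> ('g, 'a) point \<Rightarrow> ('g, 'a) point"

text \<open>Extensionality makes equality of G-sets the equality of point sets and actions;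
  likewise for G-maps below.\<close>

definition finite_gset :: "('g, 'z) monoid_scheme \<Rightarrow> ('g, 'a) gset \<Rightarrow> bool" where
  "finite_gset G X \<longleftrightarrow>
     finite (Pts X) \<and> group_action G (Pts X) (Act X) \<and> Act X \<in> extensional (carrier G)"

record ('g, 'a) gmap =
  Src :: "('g, 'a) gset"
  Tgt :: "('g, 'a) gset"
  Fun :: "('g, 'a) point \<Rightarrow> ('g, 'a) point"

definition is_gmap :: "('g, 'z) monoid_scheme \<Rightarrow> ('g, 'a) gmap \<Rightarrow> bool" where
  "is_gmap G a \<longleftrightarrow> finite_gset G (Src a) \<and> finite_gset G (Tgt a) \<and>
     Fun a \<in> Pts (Src a) \<rightarrow>\<^sub>E Pts (Tgt a) \<and>
     (\<forall>g\<in>carrier G. \<forall>x\<in>Pts (Src a). Fun a (Act (Src a) g x) = Act (Tgt a) g (Fun a x))"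

definition id_gmap :: "('g, 'a) gset \<Rightarrow> ('g, 'a) gmap" where
  "id_gmap X = \<lparr>Src = X, Tgt = X, Fun = (\<lambda>x\<in>Pts X. x)\<rparr>"

definition comp_gmap :: "('g, 'a) gmap \<Rightarrow> ('g, 'a) gmap \<Rightarrow> ('g, 'a) gmap" where
  "comp_gmap b a = \<lparr>Src = Src a, Tgt = Tgt b, Fun = compose (Pts (Src a)) (Fun b) (Fun a)\<rparr>"

text \<open>A coproduct diagram \<open>X\<^sub>1 \<rightarrow> X \<leftarrow> X\<^sub>2\<close> of finite G-sets.\<close>

definition gset_coproduct ::
  "('g, 'z) monoid_scheme \<Rightarrow> ('g, 'a) gmap \<Rightarrow> ('g, 'a) gmap \<Rightarrow> bool" where
  "gset_coproduct G i j \<longleftrightarrow> is_gmap G i \<and> is_gmap G j \<and> Tgt i = Tgt j \<and>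
     inj_on (Fun i) (Pts (Src i)) \<and> inj_on (Fun j) (Pts (Src j)) \<and>
     Fun i ` Pts (Src i) \<inter> Fun j ` Pts (Src j) = {} \<and>
     Fun i ` Pts (Src i) \<union> Fun j ` Pts (Src j) = Pts (Tgt i)"

subsection \<open>Fibre products\<close>

fun pt_fst :: "('g, 'a) point \<Rightarrow> ('g, 'a) point" where
  "pt_fst (Pt_Pair u v) = u"
| "pt_fst _ = undefined"

fun pt_snd :: "('g, 'a) point \<Rightarrow> ('g, 'a) point" where
  "pt_snd (Pt_Pair u v) = v"
| "pt_snd _ = undefined"

text \<open>\<open>U \<times>\<^sub>X U\<close> and \<open>U \<times>\<^sub>X U \<times>\<^sub>X U\<close>, the latter consisting of the triples \<open>(u, (v, w))\<close>.\<close>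

definition fibre2 :: "('g, 'z) monoid_scheme \<Rightarrow> ('g, 'a) gmap \<Rightarrow> ('g, 'a) gset" where
  "fibre2 G a =
     (let U = Src a;
          P = {Pt_Pair u v | u v. u \<in> Pts U \<and> v \<in> Pts U \<and> Fun a u = Fun a v}
      in \<lparr>Pts = P,
          Act = (\<lambda>g\<in>carrier G. \<lambda>x\<in>P. Pt_Pair (Act U g (pt_fst x)) (Act U g (pt_snd x)))\<rparr>)"

definition fibre3 :: "('g, 'z) monoid_scheme \<Rightarrow> ('g, 'a) gmap \<Rightarrow> ('g, 'a) gset" where
  "fibre3 G a =
     (let U = Src a;
          P = {Pt_Pair u (Pt_Pair v w) | u v w. u \<in> Pts U \<and> v \<in> Pts U \<and> w \<in> Pts U \<and>
                 Fun a u = Fun a v \<and> Fun a v = Fun a w}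
      in \<lparr>Pts = P,
          Act = (\<lambda>g\<in>carrier G. \<lambda>x\<in>P.
                   Pt_Pair (Act U g (pt_fst x))
                     (Pt_Pair (Act U g (pt_fst (pt_snd x))) (Act U g (pt_snd (pt_snd x)))))\<rparr>)"

definition pr1 :: "('g, 'z) monoid_scheme \<Rightarrow> ('g, 'a) gmap \<Rightarrow> ('g, 'a) gmap" where
  "pr1 G a = \<lparr>Src = fibre2 G a, Tgt = Src a, Fun = restrict pt_fst (Pts (fibre2 G a))\<rparr>"

definition pr2 :: "('g, 'z) monoid_scheme \<Rightarrow> ('g, 'a) gmap \<Rightarrow> ('g, 'a) gmap" where
  "pr2 G a = \<lparr>Src = fibre2 G a, Tgt = Src a, Fun = restrict pt_snd (Pts (fibre2 G a))\<rparr>"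

definition pr12 :: "('g, 'z) monoid_scheme \<Rightarrow> ('g, 'a) gmap \<Rightarrow> ('g, 'a) gmap" where
  "pr12 G a = \<lparr>Src = fibre3 G a, Tgt = fibre2 G a,
     Fun = (\<lambda>x\<in>Pts (fibre3 G a). Pt_Pair (pt_fst x) (pt_fst (pt_snd x)))\<rparr>"

definition pr13 :: "('g, 'z) monoid_scheme \<Rightarrow> ('g, 'a) gmap \<Rightarrow> ('g, 'a) gmap" where
  "pr13 G a = \<lparr>Src = fibre3 G a, Tgt = fibre2 G a,
     Fun = (\<lambda>x\<in>Pts (fibre3 G a). Pt_Pair (pt_fst x) (pt_snd (pt_snd x)))\<rparr>"

definition pr23 :: "('g, 'z) monoid_scheme \<Rightarrow> ('g, 'a) gmap \<Rightarrow> ('g, 'a) gmap" where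
  "pr23 G a = \<lparr>Src = fibre3 G a, Tgt = fibre2 G a,
     Fun = (\<lambda>x\<in>Pts (fibre3 G a). pt_snd x)\<rparr>"

subsection \<open>Coset spaces and the maps between them\<close>

fun pt_coset :: "('g, 'a) point \<Rightarrow> 'g set" where
  "pt_coset (Coset A) = A"
| "pt_coset _ = undefined"

definition coset_gset :: "('g, 'z) monoid_scheme \<Rightarrow> 'g set \<Rightarrow> ('g, 'a) gset" where
  "coset_gset G K =
     \<lparr>Pts = Coset ` (lcosets\<^bsub>G\<^esub> K),
      Act = (\<lambda>g\<in>carrier G. \<lambda>x\<in>Coset ` (lcosets\<^bsub>G\<^esub> K). Coset (g <#\<^bsub>G\<^esub> pt_coset x))\<rparr>"

text \<open>The map \<open>[x]\<^sub>K \<mapsto> [x g\<^sup>-\<^sup>1]\<^sub>L\<close>, meaningful when \<open>g K g\<^sup>-\<^sup>1 \<subseteq> L\<close>; a coset \<open>A = [x]\<^sub>K\<close> is sent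
  to \<open>A g\<^sup>-\<^sup>1 L\<close>, which is then the single coset \<open>[x g\<^sup>-\<^sup>1]\<^sub>L\<close> (see \<open>beta_gmap_apply\<close>).\<close>

definition beta_gmap ::
  "('g, 'z) monoid_scheme \<Rightarrow> 'g set \<Rightarrow> 'g set \<Rightarrow> 'g \<Rightarrow> ('g, 'a) gmap" where
  "beta_gmap G K L g =
     \<lparr>Src = coset_gset G K, Tgt = coset_gset G L,
      Fun = (\<lambda>x\<in>Pts (coset_gset G K). Coset (pt_coset x <#>\<^bsub>G\<^esub> (inv\<^bsub>G\<^esub> g <#\<^bsub>G\<^esub> L)))\<rparr>"

lemma beta_gmap_apply:
  fixes G :: "('g, 'z) monoid_scheme" (structure)
  assumes "group G" and "subgroup K G" and "subgroup L G" and g: "g \<in> carrier G"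
    and sub: "g <# K #> inv g \<subseteq> L" and x: "x \<in> carrier G"
  shows "Fun (beta_gmap G K L g :: ('g, 'a) gmap) (Coset (x <# K)) = Coset ((x \<otimes> inv g) <# L)"
proof -
  interpret group G by fact
  interpret K: subgroup K G by fact
  interpret L: subgroup L G by fact
  have cancel: "inv g \<otimes> (g \<otimes> z) = z" if "z \<in> carrier G" for z
    using g that by (metis inv_closed l_inv l_one m_assoc)
  have "(x <# K) <#> (inv g <# L) = (x \<otimes> inv g) <# L"
  proof (intro equalityI subsetI)
    fix y assume "y \<in> (x <# K) <#> (inv g <# L)"
    then obtain k l where k: "k \<in> K" and l: "l \<in> L" and y: "y = (x \<otimes> k) \<otimes> (inv g \<otimes> l)"
      unfolding set_mult_def l_coset_def by blast
    have *: "g \<otimes> k \<otimes> inv g \<in> L"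
      using sub k unfolding r_coset_def l_coset_def by blast
    have "y = (x \<otimes> inv g) \<otimes> ((g \<otimes> k \<otimes> inv g) \<otimes> l)"
      using k l g x K.subset L.subset by (simp add: y m_assoc cancel subset_iff)
    then show "y \<in> (x \<otimes> inv g) <# L"
      using * L.m_closed[OF * l] unfolding l_coset_def by blast
  next
    fix y assume "y \<in> (x \<otimes> inv g) <# L"
    then obtain l where l: "l \<in> L" and y: "y = (x \<otimes> inv g) \<otimes> l"
      unfolding l_coset_def by blast
    have "y = (x \<otimes> \<one>) \<otimes> (inv g \<otimes> l)"
      using l g x by (simp add: y m_assoc)
    then show "y \<in> (x <# K) <#> (inv g <# L)"
      using l K.one_closed unfolding set_mult_def l_coset_def by blast
  qed
  moreover have "Coset (x <# K) \<in> Pts (coset_gset G K :: ('g, 'a) gset)"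
    using x unfolding coset_gset_def LCOSETS_def by (simp add: image_iff) blast
  ultimately show ?thesis
    unfolding beta_gmap_def by simp
qed

text \<open>\<open>H\<^sup>g\<close>, \<open>H[g]\<close> and \<open>H[g\<^sub>2, g\<^sub>1]\<close>.\<close>

definition conj_sub :: "('g, 'z) monoid_scheme \<Rightarrow> 'g set \<Rightarrow> 'g \<Rightarrow> 'g set" where
  "conj_sub G H g = inv\<^bsub>G\<^esub> g <#\<^bsub>G\<^esub> H #>\<^bsub>G\<^esub> g"

definition cap1 :: "('g, 'z) monoid_scheme \<Rightarrow> 'g set \<Rightarrow> 'g \<Rightarrow> 'g set" where
  "cap1 G H g = conj_sub G H g \<inter> H"

definition cap2 :: "('g, 'z) monoid_scheme \<Rightarrow> 'g set \<Rightarrow> 'g \<Rightarrow> 'g \<Rightarrow> 'g set" where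
  "cap2 G H g2 g1 = conj_sub G H (g2 \<otimes>\<^bsub>G\<^esub> g1) \<inter> conj_sub G H g1 \<inter> H"

subsection \<open>Sipp-covers\<close>

definition sub_index :: "('g, 'z) monoid_scheme \<Rightarrow> 'g set \<Rightarrow> 'g set \<Rightarrow> nat" where
  "sub_index G K L = card (rcosets\<^bsub>G\<lparr>carrier := K\<rparr>\<^esub> L)"

definition sipp_cover :: "('g, 'z) monoid_scheme \<Rightarrow> nat \<Rightarrow> ('g, 'a) gmap \<Rightarrow> bool" where
  "sipp_cover G p a \<longleftrightarrow> is_gmap G a \<and>
     (\<forall>x\<in>Pts (Tgt a). \<exists>u\<in>Pts (Src a). Fun a u = x \<and>
        coprime (sub_index G (stabilizer G (Act (Tgt a)) x) (stabilizer G (Act (Src a)) u)) p)"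


section \<open>Strict presheaves of additive categories, descent, stacks\<close>

record ('g, 'a, 'o, 'm) presheaf =
  val :: "('g, 'a) gset \<Rightarrow> ('o, 'm) addcat"
  pull :: "('g, 'a) gmap \<Rightarrow> ('o, 'm, 'o, 'm) ftor"

abbreviation pull_ob :: "('g, 'a, 'o, 'm) presheaf \<Rightarrow> ('g, 'a) gmap \<Rightarrow> 'o \<Rightarrow> 'o" where
  "pull_ob D a \<equiv> omap (pull D a)"

abbreviation pull_ar :: "('g, 'a, 'o, 'm) presheaf \<Rightarrow> ('g, 'a) gmap \<Rightarrow> 'm \<Rightarrow> 'm" where
  "pull_ar D a \<equiv> amap (pull D a)"

definition strict_presheaf ::
  "('g, 'z) monoid_scheme \<Rightarrow> ('g, 'a, 'o, 'm) presheaf \<Rightarrow> bool" where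
  "strict_presheaf G D \<longleftrightarrow>
     (\<forall>X. finite_gset G X \<longrightarrow> additive_category (val D X)) \<and>
     (\<forall>a. is_gmap G a \<longrightarrow> additive_functor (val D (Tgt a)) (val D (Src a)) (pull D a)) \<and>
     (\<forall>X. finite_gset G X \<longrightarrow>
        (\<forall>V\<in>Ob (val D X). pull_ob D (id_gmap X) V = V) \<and>
        (\<forall>f\<in>Arr (val D X). pull_ar D (id_gmap X) f = f)) \<and>
     (\<forall>a b. is_gmap G a \<longrightarrow> is_gmap G b \<longrightarrow> Src b = Tgt a \<longrightarrow>
        (\<forall>V\<in>Ob (val D (Tgt b)). pull_ob D (comp_gmap b a) V = pull_ob D a (pull_ob D b V)) \<and>
        (\<forall>f\<in>Arr (val D (Tgt b)). pull_ar D (comp_gmap b a) f = pull_ar D a (pull_ar D b f)))"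

definition descent_objects ::
  "('g, 'z) monoid_scheme \<Rightarrow> ('g, 'a, 'o, 'm) presheaf \<Rightarrow> ('g, 'a) gmap \<Rightarrow> ('o \<times> 'm) set" where
  "descent_objects G D a =
     {(W, s). W \<in> Ob (val D (Src a)) \<and>
        iso_arrow (val D (fibre2 G a)) (pull_ob D (pr2 G a) W) (pull_ob D (pr1 G a) W) s \<and>
        pull_ar D (pr13 G a) s =
          pull_ar D (pr12 G a) s \<cdot>\<^bsub>val D (fibre3 G a)\<^esub> pull_ar D (pr23 G a) s}"

text \<open>A morphism \<open>f: (W, s) \<rightarrow> (W', s')\<close> is recorded together with its domain and codomain.\<close>

definition descent_cat ::
  "('g, 'z) monoid_scheme \<Rightarrow> ('g, 'a, 'o, 'm) presheaf \<Rightarrow> ('g, 'a) gmap \<Rightarrow>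
   ('o \<times> 'm, ('o \<times> 'm) \<times> ('o \<times> 'm) \<times> 'm) cat" where
  "descent_cat G D a =
     \<lparr>Ob = descent_objects G D a,
      Arr = {((W, s), (W', s'), f) | W s W' s' f.
               (W, s) \<in> descent_objects G D a \<and> (W', s') \<in> descent_objects G D a \<and>
               f \<in> arrows (val D (Src a)) W W' \<and>
               pull_ar D (pr1 G a) f \<cdot>\<^bsub>val D (fibre2 G a)\<^esub> s =
                 s' \<cdot>\<^bsub>val D (fibre2 G a)\<^esub> pull_ar D (pr2 G a) f},
      Dom = (\<lambda>(x, y, f). x),
      Cod = (\<lambda>(x, y, f). y),
      Idn = (\<lambda>x. (x, x, Idn (val D (Src a)) (fst x))),
      Cmp = (\<lambda>(y', z, g) (x, y, f). (x, z, g \<cdot>\<^bsub>val D (Src a)\<^esub> f))\<rparr>"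

text \<open>By strictness \<open>pr\<^sub>2\<^sup>* (a\<^sup>* V) = pr\<^sub>1\<^sup>* (a\<^sup>* V)\<close>, so the identity is a possible gluing isomorphism.\<close>

definition canonical_descent ::
  "('g, 'z) monoid_scheme \<Rightarrow> ('g, 'a, 'o, 'm) presheaf \<Rightarrow> ('g, 'a) gmap \<Rightarrow> 'o \<Rightarrow> 'o \<times> 'm" where
  "canonical_descent G D a V =
     (pull_ob D a V, Idn (val D (fibre2 G a)) (pull_ob D (pr2 G a) (pull_ob D a V)))"

definition descent_functor ::
  "('g, 'z) monoid_scheme \<Rightarrow> ('g, 'a, 'o, 'm) presheaf \<Rightarrow> ('g, 'a) gmap \<Rightarrow>
   ('o, 'm, 'o \<times> 'm, ('o \<times> 'm) \<times> ('o \<times> 'm) \<times> 'm) ftor" where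
  "descent_functor G D a =
     \<lparr>omap = canonical_descent G D a,
      amap = (\<lambda>f. (canonical_descent G D a (Dom (val D (Tgt a)) f),
                   canonical_descent G D a (Cod (val D (Tgt a)) f),
                   pull_ar D a f))\<rparr>"

definition strict_sipp_stack ::
  "('g, 'z) monoid_scheme \<Rightarrow> nat \<Rightarrow> ('g, 'a, 'o, 'm) presheaf \<Rightarrow> bool" where
  "strict_sipp_stack G p D \<longleftrightarrow> strict_presheaf G D \<and>
     (\<forall>a. sipp_cover G p a \<longrightarrow>
        equivalence_functor (val D (Tgt a)) (descent_cat G D a) (descent_functor G D a))"

text \<open>Compatibility with disjoint unions: \<open>D(X\<^sub>1 \<squnion> X\<^sub>2) \<rightarrow> D(X\<^sub>1) \<times> D(X\<^sub>2)\<close> is an equivalence.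
  It is descent along the covering family \<open>{X\<^sub>1 \<rightarrow> X\<^sub>1 \<squnion> X\<^sub>2, X\<^sub>2 \<rightarrow> X\<^sub>1 \<squnion> X\<^sub>2}\<close> and allows one to
  replace covering families by single covers. Descent along single covers does not imply it:
  a constant presheaf (all \<open>a\<^sup>*\<close> identities) satisfies \<open>strict_sipp_stack\<close>.\<close>

definition respects_disjoint_unions ::
  "('g, 'z) monoid_scheme \<Rightarrow> ('g, 'a, 'o, 'm) presheaf \<Rightarrow> bool" where
  "respects_disjoint_unions G D \<longleftrightarrow>
     (\<forall>i j. gset_coproduct G i j \<longrightarrow>
        equivalence_functor (val D (Tgt i)) (prod_cat (val D (Src i)) (val D (Src j)))
          \<lparr>omap = \<lambda>V. (pull_ob D i V, pull_ob D j V),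
           amap = \<lambda>f. (pull_ar D i f, pull_ar D j f)\<rparr>)"


section \<open>Gluing along \<open>G/H \<rightarrow> G/G\<close> in terms of cosets\<close>

definition coset_gluing_datum ::
  "('g, 'z) monoid_scheme \<Rightarrow> ('g, 'a, 'o, 'm) presheaf \<Rightarrow> 'g set \<Rightarrow> 'o \<Rightarrow> ('g \<Rightarrow> 'm) \<Rightarrow> bool" where
  "coset_gluing_datum G D H W s \<longleftrightarrow>
     W \<in> Ob (val D (coset_gset G H)) \<and>
     (\<forall>g\<in>carrier G.
        iso_arrow (val D (coset_gset G (cap1 G H g)))
          (pull_ob D (beta_gmap G (cap1 G H g) H \<one>\<^bsub>G\<^esub>) W)
          (pull_ob D (beta_gmap G (cap1 G H g) H g) W)
          (s g)) \<and>
     (\<forall>h\<in>H. s h = Idn (val D (coset_gset G H)) W) \<and>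
     (\<forall>g1\<in>carrier G. \<forall>g2\<in>carrier G.
        pull_ar D (beta_gmap G (cap2 G H g2 g1) (cap1 G H (g2 \<otimes>\<^bsub>G\<^esub> g1)) \<one>\<^bsub>G\<^esub>) (s (g2 \<otimes>\<^bsub>G\<^esub> g1)) =
        pull_ar D (beta_gmap G (cap2 G H g2 g1) (cap1 G H g2) g1) (s g2)
          \<cdot>\<^bsub>val D (coset_gset G (cap2 G H g2 g1))\<^esub>
        pull_ar D (beta_gmap G (cap2 G H g2 g1) (cap1 G H g1) \<one>\<^bsub>G\<^esub>) (s g1))"

definition coset_gluing ::
  "('g, 'z) monoid_scheme \<Rightarrow> ('g, 'a, 'o, 'm) presheaf \<Rightarrow> 'g set \<Rightarrow> 'o \<Rightarrow> ('g \<Rightarrow> 'm) \<Rightarrow>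
   'o \<Rightarrow> 'm \<Rightarrow> bool" where
  "coset_gluing G D H W s V f \<longleftrightarrow>
     V \<in> Ob (val D (coset_gset G (carrier G))) \<and>
     iso_arrow (val D (coset_gset G H))
       (pull_ob D (beta_gmap G H (carrier G) \<one>\<^bsub>G\<^esub>) V) W f \<and>
     (\<forall>g\<in>carrier G.
        pull_ar D (beta_gmap G (cap1 G H g) H g) f =
        s g \<cdot>\<^bsub>val D (coset_gset G (cap1 G H g))\<^esub> pull_ar D (beta_gmap G (cap1 G H g) H \<one>\<^bsub>G\<^esub>) f)"

end

theory Submission
  imports Defs
begin

text \<open>Write \<open>U = G/H\<close>. Since \<open>[G : H]\<close> is prime to \<open>p\<close>, the map \<open>\<alpha>: U \<rightarrow> G/G\<close> is a sipp-cover, so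
  \<open>D(G/G)\<close> is equivalent to the category of descent data for \<open>\<alpha>\<close>. These live on the fibre powers
  \<open>U\<^sup>2\<close> and \<open>U\<^sup>3\<close>, and everything comes down to reading them off orbit by orbit.

  The orbit of \<open>([g\<^sup>-\<^sup>1], [1])\<close> in \<open>U\<^sup>2\<close> has stabilizer \<open>H[g]\<close>, and \<open>\<gamma> g = (\<beta>\<^sub>g, \<beta>\<^sub>1): G/H[g] \<rightarrow> U\<^sup>2\<close>
  parametrizes it. Pulling back along \<open>\<gamma> g\<close> turns \<open>pr\<^sub>1\<^sup>*\<close> into \<open>\<beta>\<^sub>g\<^sup>*\<close> and \<open>pr\<^sub>2\<^sup>*\<close> into \<open>\<beta>\<^sub>1\<^sup>*\<close>, so
  that a gluing isomorphism \<open>pr\<^sub>2\<^sup>* W \<rightarrow> pr\<^sub>1\<^sup>* W\<close> restricts to isomorphisms \<open>s\<^sub>g: \<beta>\<^sub>1\<^sup>* W \<rightarrow> \<beta>\<^sub>g\<^sup>* W\<close>.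
  Likewise \<open>\<delta> g\<^sub>2 g\<^sub>1 = (\<beta>\<^bsub>g\<^sub>2g\<^sub>1\<^esub>, \<beta>\<^bsub>g\<^sub>1\<^esub>, \<beta>\<^sub>1)\<close> parametrizes the orbits of \<open>U\<^sup>3\<close> by the \<open>G/H[g\<^sub>2, g\<^sub>1]\<close>,
  and along it the cocycle condition \<open>pr\<^sub>1\<^sub>3\<^sup>* = pr\<^sub>1\<^sub>2\<^sup>* \<circ> pr\<^sub>2\<^sub>3\<^sup>*\<close> becomes condition (ii) (lemma
  \<open>pr_\<delta>\<close>).

  Compatibility with disjoint unions makes an arrow over a G-set the same as a family of arrows over
  its orbits. The index \<open>g\<close> runs through all of \<open>G\<close> instead of representatives of the double cosets
  \<open>H\<setminus>G/H\<close>, so the same orbit is parametrized many times; \<open>glue_arrows\<close> therefore asks the family to be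
  invariant under change of parametrization. Two maps \<open>\<gamma> g\<close>, \<open>\<gamma> g'\<close> have the same orbit only if
  \<open>g = h g' u\<close> with \<open>h, u \<in> H\<close> (\<open>\<gamma>_factorization\<close>), and for these the invariance of \<open>s\<close> follows from
  (i) and (ii), by taking one of the two group elements in (ii) from \<open>H\<close> (\<open>s_compatible\<close>).

  For part (a), the equality \<open>pr\<^sub>1\<^sup>* f = pr\<^sub>2\<^sup>* f\<close> that makes \<open>f\<close> a morphism of canonical descent data can be
  tested on orbits, where it reads \<open>\<beta>\<^sub>g\<^sup>* f = \<beta>\<^sub>1\<^sup>* f\<close>; then one uses that descent is fully faithful. For part
  (b), existence is essential surjectivity of descent applied to the glued datum. For uniqueness, the
  comparison \<open>f'\<^sup>-\<^sup>1 f\<close> of two solutions satisfies the condition in (a), hence comes from a unique arrow.\<close>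

section \<open>Categories\<close>

lemma comp_arrows:
  "category C \<Longrightarrow> f \<in> arrows C A B \<Longrightarrow> g \<in> arrows C B E \<Longrightarrow> g \<cdot>\<^bsub>C\<^esub> f \<in> arrows C A E"
  unfolding category_def arrows_def by blast

lemma comp_assoc:
  "category C \<Longrightarrow> f \<in> arrows C A B \<Longrightarrow> g \<in> arrows C B E \<Longrightarrow> h \<in> arrows C E F \<Longrightarrow>
   (h \<cdot>\<^bsub>C\<^esub> g) \<cdot>\<^bsub>C\<^esub> f = h \<cdot>\<^bsub>C\<^esub> (g \<cdot>\<^bsub>C\<^esub> f)"
  unfolding category_def arrows_def by simp

lemma id_arrows: "category C \<Longrightarrow> A \<in> Ob C \<Longrightarrow> Idn C A \<in> arrows C A A"
  unfolding category_def by blast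

lemma comp_id_right: "category C \<Longrightarrow> f \<in> arrows C A B \<Longrightarrow> f \<cdot>\<^bsub>C\<^esub> Idn C A = f"
  and comp_id_left: "category C \<Longrightarrow> f \<in> arrows C A B \<Longrightarrow> Idn C B \<cdot>\<^bsub>C\<^esub> f = f"
  unfolding category_def arrows_def by auto

lemma arrows_Ob:
  "category C \<Longrightarrow> f \<in> arrows C A B \<Longrightarrow> A \<in> Ob C \<and> B \<in> Ob C"
  unfolding category_def arrows_def by auto

lemma arrows_Arr: "f \<in> arrows C A B \<Longrightarrow> f \<in> Arr C"
  unfolding arrows_def by blast

lemma iso_arrowD: "iso_arrow C A B f \<Longrightarrow> f \<in> arrows C A B"
  unfolding iso_arrow_def by blast

lemma iso_arrow_inverseE:
  assumes "iso_arrow C A B f"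
  obtains g where "iso_arrow C B A g" "g \<cdot>\<^bsub>C\<^esub> f = Idn C A" "f \<cdot>\<^bsub>C\<^esub> g = Idn C B"
  using assms unfolding iso_arrow_def by blast

lemma iso_cancel_left:
  assumes C: "category C" and m: "iso_arrow C B E m"
    and f: "f \<in> arrows C A B" and f': "f' \<in> arrows C A B"
    and eq: "m \<cdot>\<^bsub>C\<^esub> f = m \<cdot>\<^bsub>C\<^esub> f'"
  shows "f = f'"
proof -
  obtain n where n: "iso_arrow C E B n" "n \<cdot>\<^bsub>C\<^esub> m = Idn C B"
    using m by (rule iso_arrow_inverseE)
  have "f = (n \<cdot>\<^bsub>C\<^esub> m) \<cdot>\<^bsub>C\<^esub> f"
    using comp_id_left[OF C f] n by simp
  also have "\<dots> = (n \<cdot>\<^bsub>C\<^esub> m) \<cdot>\<^bsub>C\<^esub> f'"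
    using comp_assoc[OF C f iso_arrowD[OF m] iso_arrowD[OF n(1)]]
      comp_assoc[OF C f' iso_arrowD[OF m] iso_arrowD[OF n(1)]] eq by simp
  also have "\<dots> = f'"
    using comp_id_left[OF C f'] n by simp
  finally show ?thesis .
qed

lemma iso_cancel_right:
  assumes C: "category C" and m: "iso_arrow C A B m"
    and f: "f \<in> arrows C B E" and f': "f' \<in> arrows C B E"
    and eq: "f \<cdot>\<^bsub>C\<^esub> m = f' \<cdot>\<^bsub>C\<^esub> m"
  shows "f = f'"
proof -
  obtain n where n: "iso_arrow C B A n" "m \<cdot>\<^bsub>C\<^esub> n = Idn C B"
    using m by (rule iso_arrow_inverseE)
  have "f = f \<cdot>\<^bsub>C\<^esub> (m \<cdot>\<^bsub>C\<^esub> n)"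
    using comp_id_right[OF C f] n by simp
  also have "\<dots> = f' \<cdot>\<^bsub>C\<^esub> (m \<cdot>\<^bsub>C\<^esub> n)"
    using comp_assoc[OF C iso_arrowD[OF n(1)] iso_arrowD[OF m] f]
      comp_assoc[OF C iso_arrowD[OF n(1)] iso_arrowD[OF m] f'] eq by simp
  also have "\<dots> = f'"
    using comp_id_right[OF C f'] n by simp
  finally show ?thesis .
qed

lemma functor_Ob: "is_functor C E F \<Longrightarrow> A \<in> Ob C \<Longrightarrow> omap F A \<in> Ob E"
  unfolding is_functor_def by blast

lemma functor_arrows:
  "is_functor C E F \<Longrightarrow> f \<in> arrows C A B \<Longrightarrow> amap F f \<in> arrows E (omap F A) (omap F B)"
  unfolding is_functor_def arrows_def by auto

lemma functor_comp:
  "is_functor C E F \<Longrightarrow> f \<in> arrows C A B \<Longrightarrow> g \<in> arrows C B B' \<Longrightarrow>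
   amap F (g \<cdot>\<^bsub>C\<^esub> f) = amap F g \<cdot>\<^bsub>E\<^esub> amap F f"
  unfolding is_functor_def arrows_def by auto

lemma functor_id: "is_functor C E F \<Longrightarrow> A \<in> Ob C \<Longrightarrow> amap F (Idn C A) = Idn E (omap F A)"
  unfolding is_functor_def by blast

lemma functor_iso:
  assumes F: "is_functor C E F" and f: "iso_arrow C A B f"
  shows "iso_arrow E (omap F A) (omap F B) (amap F f)"
proof -
  obtain g where g: "iso_arrow C B A g" "g \<cdot>\<^bsub>C\<^esub> f = Idn C A" "f \<cdot>\<^bsub>C\<^esub> g = Idn C B"
    using f by (rule iso_arrow_inverseE)
  have C: "category C"
    using F unfolding is_functor_def by blast
  note fg = iso_arrowD[OF f] iso_arrowD[OF g(1)]
  have "A \<in> Ob C" "B \<in> Ob C"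
    using arrows_Ob[OF C fg(1)] by auto
  then show ?thesis
    unfolding iso_arrow_def
    using functor_arrows[OF F fg(1)] functor_arrows[OF F fg(2)] functor_id[OF F]
      functor_comp[OF F fg(1) fg(2)] functor_comp[OF F fg(2) fg(1)] g by auto
qed

text \<open>If \<open>t\<close> is a natural isomorphism from the identity to \<open>T\<close>, then \<open>f = t\<^sup>-\<^sup>1 T(f) t\<close> can be recovered from
  \<open>T(f)\<close>. Applied to the composite of the two functors of an equivalence, this gives faithfulness.\<close>

lemma faithful_if_naturally_retracted:
  assumes C: "category C"
    and iso: "\<And>A. A \<in> Ob C \<Longrightarrow> iso_arrow C A (omap T A) (t A)"
    and nat: "\<And>f. f \<in> Arr C \<Longrightarrow> t (Cod C f) \<cdot>\<^bsub>C\<^esub> f = amap T f \<cdot>\<^bsub>C\<^esub> t (Dom C f)"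
    and f: "f \<in> arrows C A B" and f': "f' \<in> arrows C A B" and eq: "amap T f = amap T f'"
  shows "f = f'"
proof -
  have "t B \<cdot>\<^bsub>C\<^esub> f = t B \<cdot>\<^bsub>C\<^esub> f'"
    using nat[of f] nat[of f'] f f' eq unfolding arrows_def by simp
  then show ?thesis
    using iso_cancel_left[OF C iso f f'] arrows_Ob[OF C f] by blast
qed

text \<open>Naturality of \<open>t\<close> forces the preimage of \<open>h\<close> to be \<open>t\<^sup>-\<^sup>1 F'(h) t\<close>. By construction this arrow and \<open>h\<close> agree
  after applying \<open>F'\<close>, so surjectivity for \<open>F\<close> rests on the faithfulness of \<open>F'\<close>.\<close>

lemma equivalence_fully_faithful:
  assumes F: "equivalence_functor C E F" and A: "A \<in> Ob C" and B: "B \<in> Ob C"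
  shows "bij_betw (amap F) (arrows C A B) (arrows E (omap F A) (omap F B))"
proof -
  obtain F' t u where F': "is_functor E C F'"
    and t: "natural_iso C C id_ftor (comp_ftor F' F) t"
    and u: "natural_iso E E (comp_ftor F F') id_ftor u" and FF: "is_functor C E F"
    using F unfolding equivalence_functor_def by blast
  have C: "category C" and E: "category E"
    using FF unfolding is_functor_def by auto
  have ti: "iso_arrow C X (omap F' (omap F X)) (t X)" if "X \<in> Ob C" for X
    using t that unfolding natural_iso_def id_ftor_def comp_ftor_def by simp
  have tn: "t (Cod C f) \<cdot>\<^bsub>C\<^esub> f = amap F' (amap F f) \<cdot>\<^bsub>C\<^esub> t (Dom C f)" if "f \<in> Arr C" for f
    using t that unfolding natural_iso_def id_ftor_def comp_ftor_def by simp
  have ui: "iso_arrow E (omap F (omap F' X)) X (u X)" if "X \<in> Ob E" for X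
    using u that unfolding natural_iso_def id_ftor_def comp_ftor_def by simp
  have un: "u (Cod E f) \<cdot>\<^bsub>E\<^esub> amap F (amap F' f) = f \<cdot>\<^bsub>E\<^esub> u (Dom E f)" if "f \<in> Arr E" for f
    using u that unfolding natural_iso_def id_ftor_def comp_ftor_def by simp
  have faithful: "f = f'"
    if "f \<in> arrows C X Y" "f' \<in> arrows C X Y" "amap F f = amap F f'" for f f' X Y
    using faithful_if_naturally_retracted[where T = "comp_ftor F' F" and t = t, OF C] ti tn that
    unfolding comp_ftor_def by simp
  have faithful': "h = h'"
    if h: "h \<in> arrows E X Y" and h': "h' \<in> arrows E X Y" and eq: "amap F' h = amap F' h'" for h h' X Y
  proof -
    have "h \<cdot>\<^bsub>E\<^esub> u X = h' \<cdot>\<^bsub>E\<^esub> u X"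
      using un[of h] un[of h'] h h' eq unfolding arrows_def by simp
    then show ?thesis
      using iso_cancel_right[OF E ui h h'] arrows_Ob[OF E h] by blast
  qed
  have "\<exists>f\<in>arrows C A B. amap F f = h" if h: "h \<in> arrows E (omap F A) (omap F B)" for h
  proof -
    obtain b where b: "iso_arrow C (omap F' (omap F B)) B b"
      "t B \<cdot>\<^bsub>C\<^esub> b = Idn C (omap F' (omap F B))"
      using ti[OF B] by (rule iso_arrow_inverseE)
    have F'h: "amap F' h \<in> arrows C (omap F' (omap F A)) (omap F' (omap F B))"
      using functor_arrows[OF F' h] .
    note tA = iso_arrowD[OF ti[OF A]] and tB = iso_arrowD[OF ti[OF B]] and bb = iso_arrowD[OF b(1)]
    define f where "f = b \<cdot>\<^bsub>C\<^esub> (amap F' h \<cdot>\<^bsub>C\<^esub> t A)"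
    have F'ht: "amap F' h \<cdot>\<^bsub>C\<^esub> t A \<in> arrows C A (omap F' (omap F B))"
      using comp_arrows[OF C tA F'h] .
    have f: "f \<in> arrows C A B"
      unfolding f_def using comp_arrows[OF C F'ht bb] .
    have "amap F' (amap F f) \<cdot>\<^bsub>C\<^esub> t A = t B \<cdot>\<^bsub>C\<^esub> f"
      using tn[of f] f unfolding arrows_def by simp
    also have "\<dots> = amap F' h \<cdot>\<^bsub>C\<^esub> t A"
      unfolding f_def comp_assoc[OF C F'ht bb tB, symmetric] b(2) using comp_id_left[OF C F'ht] .
    finally have "amap F' (amap F f) = amap F' h"
      using iso_cancel_right[OF C ti[OF A] functor_arrows[OF F' functor_arrows[OF FF f]] F'h] by blast
    then have "amap F f = h"
      using faithful'[OF functor_arrows[OF FF f] h] by blast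
    then show ?thesis using f by blast
  qed
  then show ?thesis
    unfolding bij_betw_def inj_on_def using faithful functor_arrows[OF FF] by blast
qed

lemma bij_betw_ex1:
  assumes F: "bij_betw F S T" and y: "y \<in> T"
  shows "\<exists>!x. x \<in> S \<and> F x = y"
proof -
  obtain x where "x \<in> S" "F x = y"
    using y bij_betw_imp_surj_on[OF F] by blast
  then show ?thesis
    using inj_onD[OF bij_betw_imp_inj_on[OF F]] by blast
qed

lemma equivalence_essentially_surjective:
  assumes "equivalence_functor C E F" and "Y \<in> Ob E"
  shows "\<exists>A\<in>Ob C. \<exists>u. iso_arrow E (omap F A) Y u"
proof -
  obtain F' u where F': "is_functor E C F'" and u: "natural_iso E E (comp_ftor F F') id_ftor u"
    using assms(1) unfolding equivalence_functor_def by blast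
  have "iso_arrow E (omap F (omap F' Y)) Y (u Y)"
    using u assms(2) unfolding natural_iso_def comp_ftor_def id_ftor_def by simp
  then show ?thesis
    using functor_Ob[OF F' assms(2)] by blast
qed

section \<open>Finite G-sets\<close>

lemma (in group) group_actionI:
  assumes ext: "\<And>g. g \<in> carrier G \<Longrightarrow> \<phi> g \<in> extensional E"
    and closed: "\<And>g x. g \<in> carrier G \<Longrightarrow> x \<in> E \<Longrightarrow> \<phi> g x \<in> E"
    and one: "\<And>x. x \<in> E \<Longrightarrow> \<phi> \<one> x = x"
    and mult: "\<And>g h x. g \<in> carrier G \<Longrightarrow> h \<in> carrier G \<Longrightarrow> x \<in> E \<Longrightarrow> \<phi> (g \<otimes> h) x = \<phi> g (\<phi> h x)"
  shows "group_action G E \<phi>"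
proof -
  have "bij_betw (\<phi> g) E E" if g: "g \<in> carrier G" for g
  proof (rule bij_betw_byWitness[where f' = "\<phi> (inv g)"])
    show "\<forall>x\<in>E. \<phi> (inv g) (\<phi> g x) = x" "\<forall>x\<in>E. \<phi> g (\<phi> (inv g) x) = x"
      using mult[of "inv g" g] mult[of g "inv g"] one g by auto
    show "\<phi> g ` E \<subseteq> E" "\<phi> (inv g) ` E \<subseteq> E"
      using closed g by auto
  qed
  then have bij: "\<phi> g \<in> Bij E" if "g \<in> carrier G" for g
    using that ext unfolding Bij_def by blast
  have "\<phi> (g \<otimes> h) = compose E (\<phi> g) (\<phi> h)" if "g \<in> carrier G" "h \<in> carrier G" for g h
    using that mult ext[of "g \<otimes> h"]
    by (intro extensionalityI[where A = E]) (auto simp: compose_eq)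
  then have "\<phi> \<in> hom G (BijGroup E)"
    using bij unfolding hom_def BijGroup_def by auto
  then show ?thesis
    using group_BijGroup is_group
    unfolding group_action_def group_hom_def group_hom_axioms_def by blast
qed

lemma (in group) act_closed:
    "finite_gset G X \<Longrightarrow> g \<in> carrier G \<Longrightarrow> x \<in> Pts X \<Longrightarrow> Act X g x \<in> Pts X"
  and act_one: "finite_gset G X \<Longrightarrow> x \<in> Pts X \<Longrightarrow> Act X \<one> x = x"
  and act_mult: "finite_gset G X \<Longrightarrow> g \<in> carrier G \<Longrightarrow> h \<in> carrier G \<Longrightarrow> x \<in> Pts X \<Longrightarrow>
     Act X (g \<otimes> h) x = Act X g (Act X h x)"
proof -
  assume X: "finite_gset G X"
  then interpret group_action G "Pts X" "Act X"
    unfolding finite_gset_def by blast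
  show "g \<in> carrier G \<Longrightarrow> x \<in> Pts X \<Longrightarrow> Act X g x \<in> Pts X"
    using element_image by blast
  show "x \<in> Pts X \<Longrightarrow> Act X \<one> x = x"
    using fun_cong[OF id_eq_one, of x] by simp
  show "g \<in> carrier G \<Longrightarrow> h \<in> carrier G \<Longrightarrow> x \<in> Pts X \<Longrightarrow> Act X (g \<otimes> h) x = Act X g (Act X h x)"
    using composition_rule by blast
qed

lemma gmap_eqI:
  assumes "is_gmap G a" and "is_gmap G b" and "Src a = Src b" and "Tgt a = Tgt b"
    and "\<And>x. x \<in> Pts (Src a) \<Longrightarrow> Fun a x = Fun b x"
  shows "a = b"
proof -
  have "Fun a = Fun b"
    using assms unfolding is_gmap_def by (metis PiE_ext)
  then show ?thesis
    using assms by (cases a; cases b) simp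
qed

lemma gmap_Fun_Pts: "is_gmap G a \<Longrightarrow> x \<in> Pts (Src a) \<Longrightarrow> Fun a x \<in> Pts (Tgt a)"
  unfolding is_gmap_def by blast

lemma gmap_Fun_act:
  "is_gmap G a \<Longrightarrow> g \<in> carrier G \<Longrightarrow> x \<in> Pts (Src a) \<Longrightarrow>
   Fun a (Act (Src a) g x) = Act (Tgt a) g (Fun a x)"
  unfolding is_gmap_def by blast

lemma comp_gmap_simps [simp]:
  "Src (comp_gmap b a) = Src a" "Tgt (comp_gmap b a) = Tgt b"
  "x \<in> Pts (Src a) \<Longrightarrow> Fun (comp_gmap b a) x = Fun b (Fun a x)"
  unfolding comp_gmap_def by (auto simp: compose_eq)

lemma (in group) is_gmap_comp:
  assumes a: "is_gmap G a" and b: "is_gmap G b" and "Src b = Tgt a"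
  shows "is_gmap G (comp_gmap b a)"
proof -
  have fin: "finite_gset G (Src a)"
    using a unfolding is_gmap_def by blast
  have "Fun (comp_gmap b a) \<in> Pts (Src a) \<rightarrow>\<^sub>E Pts (Tgt b)"
    using assms gmap_Fun_Pts[OF a] gmap_Fun_Pts[OF b] unfolding comp_gmap_def compose_def by auto
  then show ?thesis
    using assms gmap_Fun_Pts[OF a] gmap_Fun_act[OF a] gmap_Fun_act[OF b] act_closed[OF fin]
    unfolding is_gmap_def by simp
qed

lemma id_gmap_simps [simp]:
  "Src (id_gmap X) = X" "Tgt (id_gmap X) = X" "x \<in> Pts X \<Longrightarrow> Fun (id_gmap X) x = x"
  unfolding id_gmap_def by auto

lemma (in group) is_gmap_id: "finite_gset G X \<Longrightarrow> is_gmap G (id_gmap X)"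
  using act_closed unfolding is_gmap_def id_gmap_def by auto

text \<open>An injective map whose image contains that of another one lets the latter factor through it;
  this compares two parametrizations of the same orbit.\<close>

lemma (in group) factor_through_injective:
  assumes a: "is_gmap G a" and b: "is_gmap G b" and tgt: "Tgt a = Tgt b"
    and inj: "inj_on (Fun b) (Pts (Src b))"
    and im: "Fun a ` Pts (Src a) \<subseteq> Fun b ` Pts (Src b)"
  obtains k where "is_gmap G k" "Src k = Src a" "Tgt k = Src b" "comp_gmap b k = a"
proof -
  define r where "r x = inv_into (Pts (Src b)) (Fun b) (Fun a x)" for x
  have r: "r x \<in> Pts (Src b)" "Fun b (r x) = Fun a x" if "x \<in> Pts (Src a)" for x
    using im that unfolding r_def by (auto intro!: inv_into_into f_inv_into_f)
  define k where "k = \<lparr>Src = Src a, Tgt = Src b, Fun = (\<lambda>x\<in>Pts (Src a). r x)\<rparr>"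
  have fin: "finite_gset G (Src a)" "finite_gset G (Src b)"
    using a b unfolding is_gmap_def by auto
  have "r (Act (Src a) g x) = Act (Src b) g (r x)"
    if g: "g \<in> carrier G" and x: "x \<in> Pts (Src a)" for g x
  proof -
    have "Fun b (r (Act (Src a) g x)) = Act (Tgt b) g (Fun b (r x))"
      using r act_closed[OF fin(1)] gmap_Fun_act[OF a g x] g x tgt by simp
    then have "Fun b (r (Act (Src a) g x)) = Fun b (Act (Src b) g (r x))"
      using gmap_Fun_act[OF b g r(1)[OF x]] by simp
    then show ?thesis
      using inj_onD[OF inj] r(1) act_closed[OF fin(1)] act_closed[OF fin(2)] g x by blast
  qed
  then have k: "is_gmap G k"
    unfolding is_gmap_def k_def using fin r act_closed[OF fin(1)] by auto
  moreover have "comp_gmap b k = a"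
    using gmap_eqI[OF is_gmap_comp[OF k b] a] r tgt unfolding k_def by simp
  ultimately show thesis
    using that[of k] unfolding k_def by simp
qed

text \<open>A map into the fibre product is a pair of maps that agree over the base.\<close>

definition pair_gmap ::
  "('g, 'z) monoid_scheme \<Rightarrow> ('g, 'a) gmap \<Rightarrow> ('g, 'a) gmap \<Rightarrow> ('g, 'a) gmap \<Rightarrow> ('g, 'a) gmap" where
  "pair_gmap G c a b =
     \<lparr>Src = Src a, Tgt = fibre2 G c, Fun = (\<lambda>x\<in>Pts (Src a). Pt_Pair (Fun a x) (Fun b x))\<rparr>"

definition triple_gmap ::
  "('g, 'z) monoid_scheme \<Rightarrow> ('g, 'a) gmap \<Rightarrow> ('g, 'a) gmap \<Rightarrow> ('g, 'a) gmap \<Rightarrow> ('g, 'a) gmap \<Rightarrow>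
   ('g, 'a) gmap" where
  "triple_gmap G c a b d =
     \<lparr>Src = Src a, Tgt = fibre3 G c,
      Fun = (\<lambda>x\<in>Pts (Src a). Pt_Pair (Fun a x) (Pt_Pair (Fun b x) (Fun d x)))\<rparr>"

lemma Pts_fibre2:
  "Pts (fibre2 G c) = {Pt_Pair u v | u v. u \<in> Pts (Src c) \<and> v \<in> Pts (Src c) \<and> Fun c u = Fun c v}"
  unfolding fibre2_def by (simp add: Let_def)

lemma Pts_fibre3:
  "Pts (fibre3 G c) = {Pt_Pair u (Pt_Pair v w) | u v w. u \<in> Pts (Src c) \<and> v \<in> Pts (Src c) \<and>
     w \<in> Pts (Src c) \<and> Fun c u = Fun c v \<and> Fun c v = Fun c w}"
  unfolding fibre3_def by (simp add: Let_def)

lemma Act_fibre2: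
  "Act (fibre2 G c) = (\<lambda>g\<in>carrier G. \<lambda>x\<in>Pts (fibre2 G c).
     Pt_Pair (Act (Src c) g (pt_fst x)) (Act (Src c) g (pt_snd x)))"
  unfolding fibre2_def by (simp add: Let_def)

lemma Act_fibre3:
  "Act (fibre3 G c) = (\<lambda>g\<in>carrier G. \<lambda>x\<in>Pts (fibre3 G c).
     Pt_Pair (Act (Src c) g (pt_fst x))
       (Pt_Pair (Act (Src c) g (pt_fst (pt_snd x))) (Act (Src c) g (pt_snd (pt_snd x)))))"
  unfolding fibre3_def by (simp add: Let_def)

lemma (in group) finite_gset_fibre2:
  assumes c: "is_gmap G c"
  shows "finite_gset G (fibre2 G c)"
proof -
  have fin: "finite_gset G (Src c)"
    using c unfolding is_gmap_def by blast
  have "Pts (fibre2 G c) \<subseteq> (\<lambda>(u, v). Pt_Pair u v) ` (Pts (Src c) \<times> Pts (Src c))"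
    unfolding Pts_fibre2 by auto
  then have "finite (Pts (fibre2 G c))"
    using fin finite_subset unfolding finite_gset_def by blast
  moreover have "group_action G (Pts (fibre2 G c)) (Act (fibre2 G c))"
  proof (rule group_actionI)
    show "Act (fibre2 G c) g \<in> extensional (Pts (fibre2 G c))" if "g \<in> carrier G" for g
      using that unfolding Act_fibre2 by simp
    show closed: "Act (fibre2 G c) g x \<in> Pts (fibre2 G c)"
      if "g \<in> carrier G" "x \<in> Pts (fibre2 G c)" for g x
      using that act_closed[OF fin] gmap_Fun_act[OF c] unfolding Act_fibre2 by (auto simp: Pts_fibre2)
    show "Act (fibre2 G c) \<one> x = x" if "x \<in> Pts (fibre2 G c)" for x
      using that act_one[OF fin] unfolding Act_fibre2 by (auto simp: Pts_fibre2)
    show "Act (fibre2 G c) (g \<otimes> h) x = Act (fibre2 G c) g (Act (fibre2 G c) h x)"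
      if "g \<in> carrier G" "h \<in> carrier G" "x \<in> Pts (fibre2 G c)" for g h x
      using closed[OF that(2,3)] that act_mult[OF fin] unfolding Act_fibre2
      by (auto simp: Pts_fibre2)
  qed
  ultimately show ?thesis
    unfolding finite_gset_def Act_fibre2 by simp
qed

lemma (in group) finite_gset_fibre3:
  assumes c: "is_gmap G c"
  shows "finite_gset G (fibre3 G c)"
proof -
  have fin: "finite_gset G (Src c)"
    using c unfolding is_gmap_def by blast
  have "Pts (fibre3 G c) \<subseteq>
      (\<lambda>(u, v, w). Pt_Pair u (Pt_Pair v w)) ` (Pts (Src c) \<times> Pts (Src c) \<times> Pts (Src c))"
    unfolding Pts_fibre3 by force
  then have "finite (Pts (fibre3 G c))"
    using fin finite_subset unfolding finite_gset_def by blast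
  moreover have "group_action G (Pts (fibre3 G c)) (Act (fibre3 G c))"
  proof (rule group_actionI)
    show "Act (fibre3 G c) g \<in> extensional (Pts (fibre3 G c))" if "g \<in> carrier G" for g
      using that unfolding Act_fibre3 by simp
    show closed: "Act (fibre3 G c) g x \<in> Pts (fibre3 G c)"
      if "g \<in> carrier G" "x \<in> Pts (fibre3 G c)" for g x
      using that act_closed[OF fin] gmap_Fun_act[OF c] unfolding Act_fibre3 by (auto simp: Pts_fibre3)
    show "Act (fibre3 G c) \<one> x = x" if "x \<in> Pts (fibre3 G c)" for x
      using that act_one[OF fin] unfolding Act_fibre3 by (auto simp: Pts_fibre3)
    show "Act (fibre3 G c) (g \<otimes> h) x = Act (fibre3 G c) g (Act (fibre3 G c) h x)"
      if "g \<in> carrier G" "h \<in> carrier G" "x \<in> Pts (fibre3 G c)" for g h x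
      using closed[OF that(2,3)] that act_mult[OF fin] unfolding Act_fibre3
      by (auto simp: Pts_fibre3)
  qed
  ultimately show ?thesis
    unfolding finite_gset_def Act_fibre3 by simp
qed

lemma projection_simps [simp]:
  "Src (pr1 G c) = fibre2 G c" "Tgt (pr1 G c) = Src c"
  "Src (pr2 G c) = fibre2 G c" "Tgt (pr2 G c) = Src c"
  "Src (pr12 G c) = fibre3 G c" "Tgt (pr12 G c) = fibre2 G c"
  "Src (pr13 G c) = fibre3 G c" "Tgt (pr13 G c) = fibre2 G c"
  "Src (pr23 G c) = fibre3 G c" "Tgt (pr23 G c) = fibre2 G c"
  unfolding pr1_def pr2_def pr12_def pr13_def pr23_def by simp_all

lemma (in group) is_gmap_projections:
  assumes c: "is_gmap G c"
  shows "is_gmap G (pr1 G c)" "is_gmap G (pr2 G c)"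
    "is_gmap G (pr12 G c)" "is_gmap G (pr13 G c)" "is_gmap G (pr23 G c)"
proof -
  have fin: "finite_gset G (Src c)"
    using c unfolding is_gmap_def by blast
  note fin2 = finite_gset_fibre2[OF c] and fin3 = finite_gset_fibre3[OF c]
  note closed2 = act_closed[OF fin2] and closed3 = act_closed[OF fin3]
  show "is_gmap G (pr1 G c)"
    unfolding is_gmap_def using fin fin2 closed2
    by (auto simp: pr1_def Pts_fibre2 Act_fibre2)
  show "is_gmap G (pr2 G c)"
    unfolding is_gmap_def using fin fin2 closed2
    by (auto simp: pr2_def Pts_fibre2 Act_fibre2)
  show "is_gmap G (pr12 G c)"
    unfolding is_gmap_def using fin3 fin2 closed3
    by (auto simp: pr12_def Pts_fibre2 Act_fibre2 Pts_fibre3 Act_fibre3)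
  show "is_gmap G (pr13 G c)"
    unfolding is_gmap_def using fin3 fin2 closed3
    by (auto simp: pr13_def Pts_fibre2 Act_fibre2 Pts_fibre3 Act_fibre3)
  show "is_gmap G (pr23 G c)"
    unfolding is_gmap_def using fin3 fin2 closed3
    by (auto simp: pr23_def Pts_fibre2 Act_fibre2 Pts_fibre3 Act_fibre3)
qed

text \<open>For a strict presheaf these identities make the composite \<open>pr\<^sub>1\<^sub>2\<^sup>* s \<circ> pr\<^sub>2\<^sub>3\<^sup>* s\<close> defined and parallel to
  \<open>pr\<^sub>1\<^sub>3\<^sup>* s\<close>.\<close>

lemma (in group) pr_pr:
  assumes c: "is_gmap G c"
  shows "comp_gmap (pr2 G c) (pr13 G c) = comp_gmap (pr2 G c) (pr23 G c)"
    "comp_gmap (pr1 G c) (pr13 G c) = comp_gmap (pr1 G c) (pr12 G c)"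
    "comp_gmap (pr1 G c) (pr23 G c) = comp_gmap (pr2 G c) (pr12 G c)"
proof -
  note P = is_gmap_projections[OF c]
  show "comp_gmap (pr2 G c) (pr13 G c) = comp_gmap (pr2 G c) (pr23 G c)"
    by (rule gmap_eqI[OF is_gmap_comp is_gmap_comp])
      (use P in \<open>auto simp: pr2_def pr13_def pr23_def Pts_fibre2 Pts_fibre3\<close>)
  show "comp_gmap (pr1 G c) (pr13 G c) = comp_gmap (pr1 G c) (pr12 G c)"
    by (rule gmap_eqI[OF is_gmap_comp is_gmap_comp])
      (use P in \<open>auto simp: pr1_def pr13_def pr12_def Pts_fibre2 Pts_fibre3\<close>)
  show "comp_gmap (pr1 G c) (pr23 G c) = comp_gmap (pr2 G c) (pr12 G c)"
    by (rule gmap_eqI[OF is_gmap_comp is_gmap_comp])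
      (use P in \<open>auto simp: pr1_def pr2_def pr12_def pr23_def Pts_fibre2 Pts_fibre3\<close>)
qed

lemma tuple_gmap_simps [simp]:
  "Src (pair_gmap G c a b) = Src a" "Tgt (pair_gmap G c a b) = fibre2 G c"
  "x \<in> Pts (Src a) \<Longrightarrow> Fun (pair_gmap G c a b) x = Pt_Pair (Fun a x) (Fun b x)"
  "Src (triple_gmap G c a b d) = Src a" "Tgt (triple_gmap G c a b d) = fibre3 G c"
  "x \<in> Pts (Src a) \<Longrightarrow>
     Fun (triple_gmap G c a b d) x = Pt_Pair (Fun a x) (Pt_Pair (Fun b x) (Fun d x))"
  unfolding pair_gmap_def triple_gmap_def by simp_all

text \<open>Three maps with a common source that become equal after composition with \<open>c\<close>. Pairs are obtained by
  repeating a leg: the pair \<open>(a, b)\<close> belongs to the instance with \<open>d = b\<close>.\<close>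

locale gmaps_over = group G for G :: "('g, 'z) monoid_scheme" (structure) +
  fixes c a b d :: "('g, 'a) gmap"
  assumes c: "is_gmap G c" and a: "is_gmap G a" and b: "is_gmap G b" and d: "is_gmap G d"
    and src: "Src b = Src a" "Src d = Src a"
    and tgt: "Tgt a = Src c" "Tgt b = Src c" "Tgt d = Src c"
    and over: "\<And>x. x \<in> Pts (Src a) \<Longrightarrow> Fun c (Fun a x) = Fun c (Fun b x)"
      "\<And>x. x \<in> Pts (Src a) \<Longrightarrow> Fun c (Fun b x) = Fun c (Fun d x)"
begin

lemma is_gmap_pair: "is_gmap G (pair_gmap G c a b)"
proof -
  have fin: "finite_gset G (Src a)"
    using a unfolding is_gmap_def by blast
  have mem: "Pt_Pair (Fun a x) (Fun b x) \<in> Pts (fibre2 G c)" if "x \<in> Pts (Src a)" for x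
    using that gmap_Fun_Pts[OF a] gmap_Fun_Pts[OF b] over src tgt unfolding Pts_fibre2 by auto
  have "Fun (pair_gmap G c a b) (Act (Src a) g x) =
      Act (fibre2 G c) g (Fun (pair_gmap G c a b) x)"
    if "g \<in> carrier G" "x \<in> Pts (Src a)" for g x
    using that act_closed[OF fin] mem gmap_Fun_act[OF a] gmap_Fun_act[OF b] src tgt
    by (simp add: Act_fibre2)
  then show ?thesis
    using fin finite_gset_fibre2[OF c] mem unfolding is_gmap_def by (auto simp: pair_gmap_def)
qed

lemma is_gmap_triple: "is_gmap G (triple_gmap G c a b d)"
proof -
  have fin: "finite_gset G (Src a)"
    using a unfolding is_gmap_def by blast
  have mem: "Pt_Pair (Fun a x) (Pt_Pair (Fun b x) (Fun d x)) \<in> Pts (fibre3 G c)"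
    if "x \<in> Pts (Src a)" for x
    using that gmap_Fun_Pts[OF a] gmap_Fun_Pts[OF b] gmap_Fun_Pts[OF d] over src tgt
    unfolding Pts_fibre3 by force
  have "Fun (triple_gmap G c a b d) (Act (Src a) g x) =
      Act (fibre3 G c) g (Fun (triple_gmap G c a b d) x)"
    if "g \<in> carrier G" "x \<in> Pts (Src a)" for g x
    using that act_closed[OF fin] mem gmap_Fun_act[OF a] gmap_Fun_act[OF b] gmap_Fun_act[OF d] src tgt
    by (simp add: Act_fibre3)
  then show ?thesis
    using fin finite_gset_fibre3[OF c] mem unfolding is_gmap_def by (auto simp: triple_gmap_def)
qed

lemma pr_pair:
  "comp_gmap (pr1 G c) (pair_gmap G c a b) = a" "comp_gmap (pr2 G c) (pair_gmap G c a b) = b"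
proof -
  note P = is_gmap_pair is_gmap_projections[OF c]
  have mem: "Pt_Pair (Fun a x) (Fun b x) \<in> Pts (fibre2 G c)" if "x \<in> Pts (Src a)" for x
    using gmap_Fun_Pts[OF is_gmap_pair, of x] that by simp
  show "comp_gmap (pr1 G c) (pair_gmap G c a b) = a"
    by (rule gmap_eqI[OF is_gmap_comp a]) (use P tgt mem in \<open>auto simp: pr1_def\<close>)
  show "comp_gmap (pr2 G c) (pair_gmap G c a b) = b"
    by (rule gmap_eqI[OF is_gmap_comp b]) (use P src tgt mem in \<open>auto simp: pr2_def\<close>)
qed

end

lemma (in gmaps_over) pr_triple:
  "comp_gmap (pr12 G c) (triple_gmap G c a b d) = pair_gmap G c a b"
  "comp_gmap (pr13 G c) (triple_gmap G c a b d) = pair_gmap G c a d"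
  "comp_gmap (pr23 G c) (triple_gmap G c a b d) = pair_gmap G c b d"
proof -
  interpret ad: gmaps_over G c a d d
    using c a d src tgt over by unfold_locales auto
  interpret bd: gmaps_over G c b d d
    using c b d src tgt over by unfold_locales auto
  note P = is_gmap_triple is_gmap_projections[OF c]
  have mem: "Pt_Pair (Fun a x) (Pt_Pair (Fun b x) (Fun d x)) \<in> Pts (fibre3 G c)"
    if "x \<in> Pts (Src a)" for x
    using gmap_Fun_Pts[OF is_gmap_triple, of x] that by simp
  show "comp_gmap (pr12 G c) (triple_gmap G c a b d) = pair_gmap G c a b"
    by (rule gmap_eqI[OF is_gmap_comp is_gmap_pair]) (use P mem in \<open>auto simp: pr12_def\<close>)
  show "comp_gmap (pr13 G c) (triple_gmap G c a b d) = pair_gmap G c a d"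
    by (rule gmap_eqI[OF is_gmap_comp ad.is_gmap_pair]) (use P mem in \<open>auto simp: pr13_def\<close>)
  show "comp_gmap (pr23 G c) (triple_gmap G c a b d) = pair_gmap G c b d"
    by (rule gmap_eqI[OF is_gmap_comp bd.is_gmap_pair]) (use P mem src in \<open>auto simp: pr23_def\<close>)
qed

lemma pair_comp_gmap:
  assumes "Src a = Tgt k" and "Src b = Tgt k" and "is_gmap G k"
  shows "comp_gmap (pair_gmap G c a b) k = pair_gmap G c (comp_gmap a k) (comp_gmap b k)"
  using assms gmap_Fun_Pts[OF assms(3)] unfolding comp_gmap_def pair_gmap_def compose_def
  by (auto simp: restrict_def fun_eq_iff)

section \<open>Coset spaces\<close>

lemma (in group) inv_cancel_left:
    "x \<in> carrier G \<Longrightarrow> y \<in> carrier G \<Longrightarrow> inv x \<otimes> (x \<otimes> y) = y"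
    "x \<in> carrier G \<Longrightarrow> y \<in> carrier G \<Longrightarrow> x \<otimes> (inv x \<otimes> y) = y"
  by (simp_all flip: m_assoc)

text \<open>As rewrite rules these push inverses down to the letters, associate to the right and cancel, so the
  simplifier decides the identities between group words that occur below.\<close>

lemmas (in group) group_normalize = m_assoc inv_mult_group inv_cancel_left

lemma (in group) lcoset_eq_iff:
  assumes K: "subgroup K G" and x: "x \<in> carrier G" and y: "y \<in> carrier G"
  shows "x <# K = y <# K \<longleftrightarrow> inv x \<otimes> y \<in> K"
proof
  note [simp] = subgroup.mem_carrier[OF K]
  assume "x <# K = y <# K"
  then have "y \<in> x <# K"
    using lcos_self[OF y K] by simp
  then obtain k where "k \<in> K" "y = x \<otimes> k"
    unfolding l_coset_def by blast
  then show "inv x \<otimes> y \<in> K"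
    using x by (simp add: group_normalize)
next
  note [simp] = subgroup.mem_carrier[OF K]
  assume xy: "inv x \<otimes> y \<in> K"
  have "x \<otimes> k \<in> y <# K" if k: "k \<in> K" for k
  proof -
    have "x \<otimes> k = y \<otimes> (inv (inv x \<otimes> y) \<otimes> k)"
      using x y k by (simp add: group_normalize)
    then show ?thesis
      using subgroup.m_closed[OF K subgroup.m_inv_closed[OF K xy] k] unfolding l_coset_def by blast
  qed
  moreover have "y \<otimes> k \<in> x <# K" if k: "k \<in> K" for k
  proof -
    have "y \<otimes> k = x \<otimes> ((inv x \<otimes> y) \<otimes> k)"
      using x y k by (simp add: group_normalize)
    then show ?thesis
      using subgroup.m_closed[OF K xy k] unfolding l_coset_def by blast
  qed
  ultimately show "x <# K = y <# K"
    unfolding l_coset_def by blast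
qed

lemma Pts_coset_gset: "Pts (coset_gset G K) = {Coset (x <#\<^bsub>G\<^esub> K) | x. x \<in> carrier G}"
  unfolding coset_gset_def LCOSETS_def by auto

lemma (in group) Act_coset_gset:
  assumes "subgroup K G" and "g \<in> carrier G" and "x \<in> carrier G"
  shows "Act (coset_gset G K) g (Coset (x <# K) :: ('a, 'p) point) = Coset ((g \<otimes> x) <# K)"
proof -
  have "(Coset (x <# K) :: ('a, 'p) point) \<in> Coset ` (lcosets K)"
    using assms unfolding LCOSETS_def by blast
  moreover have "g <# (x <# K) = (g \<otimes> x) <# K"
    using assms lcos_m_assoc subgroup.subset by metis
  ultimately show ?thesis
    using assms unfolding coset_gset_def by simp
qed

lemma (in group) finite_gset_coset:
  assumes fin: "finite (carrier G)" and K: "subgroup K G"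
  shows "finite_gset G (coset_gset G K :: ('a, 'p) gset)"
proof -
  let ?X = "coset_gset G K :: ('a, 'p) gset"
  have "finite (Pts ?X)"
    unfolding Pts_coset_gset using fin by simp
  moreover have "group_action G (Pts ?X) (Act ?X)"
  proof (rule group_actionI)
    show "Act ?X g \<in> extensional (Pts ?X)" if "g \<in> carrier G" for g
      using that unfolding coset_gset_def by simp
  qed (auto simp: Pts_coset_gset Act_coset_gset[OF K] m_assoc)
  moreover have "Act ?X \<in> extensional (carrier G)"
    unfolding coset_gset_def by simp
  ultimately show ?thesis
    unfolding finite_gset_def by blast
qed

text \<open>The condition for \<open>\<beta>\<^sub>g: G/K \<rightarrow> G/L\<close> to be well defined.\<close>

definition conjugates_into :: "('g, 'z) monoid_scheme \<Rightarrow> 'g \<Rightarrow> 'g set \<Rightarrow> 'g set \<Rightarrow> bool" where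
  "conjugates_into G g K L \<longleftrightarrow> (\<forall>k\<in>K. g \<otimes>\<^bsub>G\<^esub> k \<otimes>\<^bsub>G\<^esub> inv\<^bsub>G\<^esub> g \<in> L)"

lemma beta_gmap_simps [simp]:
  "Src (beta_gmap G K L g) = coset_gset G K" "Tgt (beta_gmap G K L g) = coset_gset G L"
  unfolding beta_gmap_def by simp_all

lemma (in group) Fun_beta_gmap:
  assumes "subgroup K G" and "subgroup L G" and "g \<in> carrier G" and "conjugates_into G g K L"
    and "x \<in> carrier G"
  shows "Fun (beta_gmap G K L g) (Coset (x <# K)) = Coset ((x \<otimes> inv g) <# L)"
proof -
  have "g <# K #> inv g \<subseteq> L"
    using assms(4) unfolding conjugates_into_def l_coset_def r_coset_def by blast
  then show ?thesis
    using beta_gmap_apply[OF is_group] assms by blast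
qed

lemma (in group) is_gmap_beta:
  assumes fin: "finite (carrier G)" and K: "subgroup K G" and L: "subgroup L G"
    and g: "g \<in> carrier G" and gKL: "conjugates_into G g K L"
  shows "is_gmap G (beta_gmap G K L g :: ('a, 'p) gmap)"
proof -
  let ?\<beta> = "beta_gmap G K L g :: ('a, 'p) gmap"
  have "Fun ?\<beta> \<in> Pts (coset_gset G K) \<rightarrow>\<^sub>E Pts (coset_gset G L)"
  proof
    show "Fun ?\<beta> x \<in> Pts (coset_gset G L)" if "x \<in> Pts (coset_gset G K)" for x
      using that g by (auto simp: Pts_coset_gset Fun_beta_gmap[OF K L g gKL])
    show "Fun ?\<beta> x = undefined" if "x \<notin> Pts (coset_gset G K)" for x
      using that unfolding beta_gmap_def by simp
  qed
  moreover have "Fun ?\<beta> (Act (coset_gset G K) y x) =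
      Act (coset_gset G L) y (Fun ?\<beta> x)"
    if "y \<in> carrier G" "x \<in> Pts (coset_gset G K)" for x y
    using that g
    by (auto simp: Pts_coset_gset m_assoc Fun_beta_gmap[OF K L g gKL] Act_coset_gset[OF K]
        Act_coset_gset[OF L])
  ultimately show ?thesis
    unfolding is_gmap_def by (simp add: finite_gset_coset[OF fin] K L)
qed

lemma (in group) comp_beta_gmap:
  assumes fin: "finite (carrier G)" and K: "subgroup K G" and L: "subgroup L G" and M: "subgroup M G"
    and g: "g \<in> carrier G" and gKL: "conjugates_into G g K L"
    and h: "h \<in> carrier G" and hLM: "conjugates_into G h L M"
  shows "comp_gmap (beta_gmap G L M h) (beta_gmap G K L g) =
    (beta_gmap G K M (h \<otimes> g) :: ('a, 'p) gmap)" (is "comp_gmap ?h ?g = ?hg")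
proof -
  have "h \<otimes> g \<otimes> k \<otimes> inv (h \<otimes> g) \<in> M" if k: "k \<in> K" for k
  proof -
    have "h \<otimes> (g \<otimes> k \<otimes> inv g) \<otimes> inv h \<in> M"
      using gKL hLM k unfolding conjugates_into_def by blast
    then show ?thesis
      using g h subgroup.mem_carrier[OF K k] by (simp add: group_normalize)
  qed
  then have hgKM: "conjugates_into G (h \<otimes> g) K M"
    unfolding conjugates_into_def by blast
  show ?thesis
  proof (rule gmap_eqI)
    show "is_gmap G (comp_gmap ?h ?g)"
      using is_gmap_comp[OF is_gmap_beta[OF fin K L g gKL] is_gmap_beta[OF fin L M h hLM]] by simp
    show "is_gmap G ?hg"
      using is_gmap_beta[OF fin K M _ hgKM] g h by simp
    fix x assume "x \<in> Pts (Src (comp_gmap ?h ?g))"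
    then obtain y where y: "y \<in> carrier G" and x: "x = Coset (y <# K)"
      by (auto simp: Pts_coset_gset)
    have "x \<in> Pts (coset_gset G K)"
      using x y by (auto simp: Pts_coset_gset)
    then show "Fun (comp_gmap ?h ?g) x = Fun ?hg x"
      using g h y by (simp add: x group_normalize Fun_beta_gmap[OF K L g gKL]
          Fun_beta_gmap[OF L M h hLM] Fun_beta_gmap[OF K M _ hgKM])
  qed simp_all
qed

lemma (in group) beta_gmap_one:
  assumes fin: "finite (carrier G)" and K: "subgroup K G"
  shows "beta_gmap G K K \<one> = id_gmap (coset_gset G K)"
proof -
  have 1: "conjugates_into G \<one> K K"
    unfolding conjugates_into_def using subgroup.mem_carrier[OF K] by simp
  show ?thesis
    by (rule gmap_eqI[OF is_gmap_beta[OF fin K K _ 1] is_gmap_id[OF finite_gset_coset[OF fin K]]])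
      (auto simp: Pts_coset_gset Fun_beta_gmap[OF K K _ 1])
qed

definition transitive_gset :: "('g, 'z) monoid_scheme \<Rightarrow> ('g, 'a) gset \<Rightarrow> bool" where
  "transitive_gset G X \<longleftrightarrow> Pts X \<noteq> {} \<and> (\<forall>x\<in>Pts X. \<forall>y\<in>Pts X. \<exists>g\<in>carrier G. Act X g x = y)"

lemma (in group) transitive_coset_gset:
  assumes K: "subgroup K G"
  shows "transitive_gset G (coset_gset G K)"
proof -
  have "\<exists>g\<in>carrier G. g \<otimes> x = y" if "x \<in> carrier G" "y \<in> carrier G" for x y
    using that by (intro bexI[where x = "y \<otimes> inv x"]) (simp_all add: group_normalize)
  then show ?thesis
    unfolding transitive_gset_def by (fastforce simp: Pts_coset_gset Act_coset_gset[OF K])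
qed

text \<open>A map out of a coset space is determined by the image of the base point.\<close>

lemma (in group) gmap_from_coset_eqI:
  assumes K: "subgroup K G" and a: "is_gmap G a" and b: "is_gmap G b"
    and src: "Src a = coset_gset G K" "Src b = coset_gset G K" and tgt: "Tgt a = Tgt b"
    and base: "Fun a (Coset (\<one> <# K)) = Fun b (Coset (\<one> <# K))"
  shows "a = b"
proof (rule gmap_eqI[OF a b])
  fix x assume "x \<in> Pts (Src a)"
  then obtain y where y: "y \<in> carrier G" and x: "x = Act (coset_gset G K) y (Coset (\<one> <# K))"
    unfolding src by (force simp: Pts_coset_gset Act_coset_gset[OF K])
  have "Coset (\<one> <# K) \<in> Pts (Src a)"
    unfolding src Pts_coset_gset by blast
  then show "Fun a x = Fun b x"
    unfolding x using gmap_Fun_act[OF a y] gmap_Fun_act[OF b y] src tgt base by simp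
qed (use src tgt in simp_all)

lemma (in group) mem_conj_sub_iff:
  assumes H: "H \<subseteq> carrier G" and g: "g \<in> carrier G"
  shows "x \<in> conj_sub G H g \<longleftrightarrow> x \<in> carrier G \<and> g \<otimes> x \<otimes> inv g \<in> H"
proof
  assume "x \<in> conj_sub G H g"
  then obtain h where "h \<in> H" "x = inv g \<otimes> h \<otimes> g"
    unfolding conj_sub_def l_coset_def r_coset_def by blast
  then show "x \<in> carrier G \<and> g \<otimes> x \<otimes> inv g \<in> H"
    using g H by (auto simp: group_normalize subset_iff)
next
  assume x: "x \<in> carrier G \<and> g \<otimes> x \<otimes> inv g \<in> H"
  then have "x = inv g \<otimes> (g \<otimes> x \<otimes> inv g) \<otimes> g"
    using g by (simp add: group_normalize)
  then show "x \<in> conj_sub G H g"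
    unfolding conj_sub_def l_coset_def r_coset_def using x by blast
qed

lemma (in group) subgroup_conj_sub:
  assumes H: "subgroup H G" and g: "g \<in> carrier G"
  shows "subgroup (conj_sub G H g) G"
proof (rule subgroupI)
  note mem = mem_conj_sub_iff[OF subgroup.subset[OF H] g]
  show "conj_sub G H g \<subseteq> carrier G"
    using mem by blast
  have "\<one> \<in> conj_sub G H g"
    using mem g subgroup.one_closed[OF H] by simp
  then show "conj_sub G H g \<noteq> {}" by blast
  show "inv x \<in> conj_sub G H g" if "x \<in> conj_sub G H g" for x
  proof -
    have x: "x \<in> carrier G" "g \<otimes> x \<otimes> inv g \<in> H"
      using that mem by auto
    have "inv (g \<otimes> x \<otimes> inv g) = g \<otimes> inv x \<otimes> inv g"
      using x g by (simp add: group_normalize)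
    then show ?thesis
      using mem x subgroup.m_inv_closed[OF H x(2)] by simp
  qed
  show "x \<otimes> y \<in> conj_sub G H g" if "x \<in> conj_sub G H g" "y \<in> conj_sub G H g" for x y
  proof -
    have x: "x \<in> carrier G" "g \<otimes> x \<otimes> inv g \<in> H" and y: "y \<in> carrier G" "g \<otimes> y \<otimes> inv g \<in> H"
      using that mem by auto
    have "(g \<otimes> x \<otimes> inv g) \<otimes> (g \<otimes> y \<otimes> inv g) = g \<otimes> (x \<otimes> y) \<otimes> inv g"
      using x y g by (simp add: group_normalize)
    then show ?thesis
      using mem x y subgroup.m_closed[OF H x(2) y(2)] by simp
  qed
qed

section \<open>Gluing arrows over the orbits of a G-set\<close>

definition inclusion_gmap ::
  "('g, 'z) monoid_scheme \<Rightarrow> ('g, 'a) gset \<Rightarrow> ('g, 'a) point set \<Rightarrow> ('g, 'a) gmap" where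
  "inclusion_gmap G X S =
     \<lparr>Src = \<lparr>Pts = S, Act = (\<lambda>g\<in>carrier G. restrict (Act X g) S)\<rparr>, Tgt = X, Fun = (\<lambda>x\<in>S. x)\<rparr>"

text \<open>The image of a G-map is stable under \<open>G\<close>; applying \<open>g\<^sup>-\<^sup>1\<close> shows that so is its complement.\<close>

lemma (in group) coproduct_with_complement:
  assumes i: "is_gmap G i" and inj: "inj_on (Fun i) (Pts (Src i))"
  defines "S \<equiv> Pts (Tgt i) - Fun i ` Pts (Src i)"
  shows "gset_coproduct G i (inclusion_gmap G (Tgt i) S)"
proof -
  have X: "finite_gset G (Tgt i)" and Y: "finite_gset G (Src i)"
    using i unfolding is_gmap_def by auto
  have closed: "Act (Tgt i) g x \<in> S" if g: "g \<in> carrier G" and x: "x \<in> S" for g x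
  proof -
    have xX: "x \<in> Pts (Tgt i)"
      using x unfolding S_def by blast
    have "x = Fun i (Act (Src i) (inv g) y)" if y: "y \<in> Pts (Src i)" "Act (Tgt i) g x = Fun i y" for y
    proof -
      have "Fun i (Act (Src i) (inv g) y) = Act (Tgt i) (inv g) (Act (Tgt i) g x)"
        using gmap_Fun_act[OF i] g y by simp
      also have "\<dots> = x"
        using act_mult[OF X _ g xX, of "inv g"] act_one[OF X xX] g by simp
      finally show ?thesis ..
    qed
    then show ?thesis
      using x g act_closed[OF X g xX] act_closed[OF Y] unfolding S_def by blast
  qed
  have sub: "S \<subseteq> Pts (Tgt i)"
    unfolding S_def by blast
  have "group_action G S (\<lambda>g\<in>carrier G. restrict (Act (Tgt i) g) S)"
    by (rule group_actionI) (use closed sub act_one[OF X] act_mult[OF X] in auto)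
  moreover have "finite S"
    using X unfolding S_def finite_gset_def by blast
  ultimately have "is_gmap G (inclusion_gmap G (Tgt i) S)"
    using X closed sub unfolding is_gmap_def finite_gset_def inclusion_gmap_def by auto
  then show ?thesis
    using i inj sub gmap_Fun_Pts[OF i] unfolding gset_coproduct_def S_def inclusion_gmap_def
    by (auto simp: inj_on_def)
qed

lemma comp_gmap_assoc:
  assumes "is_gmap G a" and "Src b = Tgt a"
  shows "comp_gmap (comp_gmap c b) a = comp_gmap c (comp_gmap b a)"
  using assms gmap_Fun_Pts[OF assms(1)] unfolding comp_gmap_def compose_def
  by (auto simp: restrict_def fun_eq_iff)

text \<open>A family of parametrizations of the orbits of \<open>X\<close>. Each orbit occurs at least once, and may occur for
  several indices.\<close>

definition orbit_cover ::
  "('g, 'z) monoid_scheme \<Rightarrow> ('g, 'a) gset \<Rightarrow> 'i set \<Rightarrow> ('i \<Rightarrow> ('g, 'a) gmap) \<Rightarrow> bool" where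
  "orbit_cover G X I \<gamma> \<longleftrightarrow>
     (\<forall>l\<in>I. is_gmap G (\<gamma> l) \<and> Tgt (\<gamma> l) = X \<and> inj_on (Fun (\<gamma> l)) (Pts (Src (\<gamma> l))) \<and>
        transitive_gset G (Src (\<gamma> l))) \<and>
     (\<forall>x\<in>Pts X. \<exists>l\<in>I. x \<in> Fun (\<gamma> l) ` Pts (Src (\<gamma> l)))"

lemma (in group) transitive_image_dichotomy:
  assumes a: "is_gmap G a" and b: "is_gmap G b" and tgt: "Tgt a = Tgt b"
    and trans: "transitive_gset G (Src a)"
    and meet: "Fun a ` Pts (Src a) \<inter> Fun b ` Pts (Src b) \<noteq> {}"
  shows "Fun a ` Pts (Src a) \<subseteq> Fun b ` Pts (Src b)"
proof
  obtain q where "q \<in> Fun a ` Pts (Src a)" "q \<in> Fun b ` Pts (Src b)"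
    using meet by blast
  then obtain x y where x: "x \<in> Pts (Src a)" and y: "y \<in> Pts (Src b)" and xy: "Fun a x = Fun b y"
    by auto
  fix p assume "p \<in> Fun a ` Pts (Src a)"
  then obtain z where z: "z \<in> Pts (Src a)" and pz: "p = Fun a z"
    by blast
  obtain g where g: "g \<in> carrier G" and "Act (Src a) g x = z"
    using trans x z unfolding transitive_gset_def by blast
  then have p: "p = Fun a (Act (Src a) g x)"
    using pz by simp
  have fin: "finite_gset G (Src b)"
    using b unfolding is_gmap_def by blast
  have "p = Fun b (Act (Src b) g y)"
    using p gmap_Fun_act[OF a g x] gmap_Fun_act[OF b g y] xy tgt by simp
  then show "p \<in> Fun b ` Pts (Src b)"
    using act_closed[OF fin g y] by blast
qed

locale gset_sheaf = group G for G :: "('g, 'z) monoid_scheme" (structure) +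
  fixes D :: "('g, 'a, 'o, 'm) presheaf"
  assumes strict: "strict_presheaf G D" and disjoint_unions: "respects_disjoint_unions G D"
begin

lemma additive_val: "finite_gset G X \<Longrightarrow> additive_category (val D X)"
  using strict unfolding strict_presheaf_def by blast

lemma category_val: "finite_gset G X \<Longrightarrow> category (val D X)"
  using additive_val unfolding additive_category_def preadditive_def by blast

lemma pull_functor: "is_gmap G a \<Longrightarrow> is_functor (val D (Tgt a)) (val D (Src a)) (pull D a)"
  using strict unfolding strict_presheaf_def additive_functor_def by blast

lemmas pull_arrows = functor_arrows[OF pull_functor]
lemmas pull_Ob = functor_Ob[OF pull_functor]
lemmas pull_cmp = functor_comp[OF pull_functor]
lemmas pull_iso = functor_iso[OF pull_functor]

lemma pull_id:
  assumes X: "finite_gset G X"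
  shows "V \<in> Ob (val D X) \<Longrightarrow> pull_ob D (id_gmap X) V = V"
    and "f \<in> arrows (val D X) A B \<Longrightarrow> pull_ar D (id_gmap X) f = f"
proof -
  note * = strict[unfolded strict_presheaf_def, THEN conjunct2, THEN conjunct2, THEN conjunct1,
      THEN spec, THEN mp, OF X]
  show "V \<in> Ob (val D X) \<Longrightarrow> pull_ob D (id_gmap X) V = V"
    by (rule bspec[OF *[THEN conjunct1]])
  show "f \<in> arrows (val D X) A B \<Longrightarrow> pull_ar D (id_gmap X) f = f"
    by (rule bspec[OF *[THEN conjunct2] arrows_Arr])
qed

lemma pull_comp_gmap:
  assumes a: "is_gmap G a" and b: "is_gmap G b" and ab: "Src b = Tgt a"
  shows "V \<in> Ob (val D (Tgt b)) \<Longrightarrow> pull_ob D (comp_gmap b a) V = pull_ob D a (pull_ob D b V)"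
    and "f \<in> arrows (val D (Tgt b)) A B \<Longrightarrow>
      pull_ar D (comp_gmap b a) f = pull_ar D a (pull_ar D b f)"
proof -
  note * = strict[unfolded strict_presheaf_def, THEN conjunct2, THEN conjunct2, THEN conjunct2,
      THEN spec, THEN spec, THEN mp, THEN mp, THEN mp, OF a b ab]
  show "V \<in> Ob (val D (Tgt b)) \<Longrightarrow> pull_ob D (comp_gmap b a) V = pull_ob D a (pull_ob D b V)"
    by (rule bspec[OF *[THEN conjunct1]])
  show "f \<in> arrows (val D (Tgt b)) A B \<Longrightarrow>
      pull_ar D (comp_gmap b a) f = pull_ar D a (pull_ar D b f)"
    by (rule bspec[OF *[THEN conjunct2] arrows_Arr])
qed

lemma coproduct_arrows:
  assumes ij: "gset_coproduct G i j" and X: "Tgt i = X"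
    and A: "A \<in> Ob (val D X)" and B: "B \<in> Ob (val D X)"
    and u: "u \<in> arrows (val D (Src i)) (pull_ob D i A) (pull_ob D i B)"
    and v: "v \<in> arrows (val D (Src j)) (pull_ob D j A) (pull_ob D j B)"
  shows "\<exists>!f. f \<in> arrows (val D X) A B \<and> pull_ar D i f = u \<and> pull_ar D j f = v"
proof -
  let ?P = "prod_cat (val D (Src i)) (val D (Src j))"
  have "(u, v) \<in> arrows ?P (pull_ob D i A, pull_ob D j A) (pull_ob D i B, pull_ob D j B)"
    using u v unfolding arrows_def prod_cat_def by simp
  moreover have "bij_betw (\<lambda>f. (pull_ar D i f, pull_ar D j f)) (arrows (val D X) A B)
      (arrows ?P (pull_ob D i A, pull_ob D j A) (pull_ob D i B, pull_ob D j B))"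
  proof -
    have "equivalence_functor (val D X) ?P
        \<lparr>omap = \<lambda>V. (pull_ob D i V, pull_ob D j V), amap = \<lambda>f. (pull_ar D i f, pull_ar D j f)\<rparr>"
      using disjoint_unions ij X unfolding respects_disjoint_unions_def by blast
    from equivalence_fully_faithful[OF this A B] show ?thesis
      by simp
  qed
  ultimately have "\<exists>!f. f \<in> arrows (val D X) A B \<and> (pull_ar D i f, pull_ar D j f) = (u, v)"
    by (rule bij_betw_ex1[rotated])
  then show ?thesis by simp
qed

text \<open>The empty G-set is the disjoint union of two copies of itself, so the diagonal map from a hom-set over it
  to its square is bijective; a hom-set of an additive category is nonempty.\<close>

lemma arrows_over_empty:
  assumes X: "finite_gset G X" and empty: "Pts X = {}"
    and A: "A \<in> Ob (val D X)" and B: "B \<in> Ob (val D X)"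
  shows "\<exists>!f. f \<in> arrows (val D X) A B"
proof -
  have "comm_group \<lparr>carrier = arrows (val D X) A B, monoid.mult = Plus (val D X), one = Zero (val D X) A B\<rparr>"
    using additive_val[OF X] A B unfolding additive_category_def preadditive_def by blast
  then interpret hom: comm_group
    "\<lparr>carrier = arrows (val D X) A B, monoid.mult = Plus (val D X), one = Zero (val D X) A B\<rparr>" .
  have "Zero (val D X) A B \<in> arrows (val D X) A B"
    using hom.one_closed by simp
  moreover have "f = f'" if f: "f \<in> arrows (val D X) A B" and f': "f' \<in> arrows (val D X) A B" for f f'
  proof -
    have "gset_coproduct G (id_gmap X) (id_gmap X)"
      using is_gmap_id[OF X] empty unfolding gset_coproduct_def by simp
    then have "\<exists>!h. h \<in> arrows (val D X) A B \<and>
        pull_ar D (id_gmap X) h = f \<and> pull_ar D (id_gmap X) h = f'"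
      by (rule coproduct_arrows) (use A B f f' in \<open>simp_all add: pull_id(1)[OF X]\<close>)
    then show ?thesis by auto
  qed
  ultimately show ?thesis by blast
qed

text \<open>Induction on the number of points: split off the orbit of one index \<open>l0\<close> and glue the arrow given there
  to the one obtained by induction on the complement. For the other indices whose image is the orbit of
  \<open>l0\<close>, the restriction of the result is prescribed by \<open>t l0\<close>, and the compatibility hypothesis says that
  it is the given arrow.\<close>

lemma glue_arrows:
  assumes "finite_gset G X" and "orbit_cover G X I \<gamma>"
    and "A \<in> Ob (val D X)" and "B \<in> Ob (val D X)"
    and "\<And>l. l \<in> I \<Longrightarrow> t l \<in> arrows (val D (Src (\<gamma> l))) (pull_ob D (\<gamma> l) A) (pull_ob D (\<gamma> l) B)"
    and "\<And>l l' k. l \<in> I \<Longrightarrow> l' \<in> I \<Longrightarrow> is_gmap G k \<Longrightarrow> Src k = Src (\<gamma> l) \<Longrightarrow> Tgt k = Src (\<gamma> l') \<Longrightarrow>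
      comp_gmap (\<gamma> l') k = \<gamma> l \<Longrightarrow> pull_ar D k (t l') = t l"
  shows "\<exists>!f. f \<in> arrows (val D X) A B \<and> (\<forall>l\<in>I. pull_ar D (\<gamma> l) f = t l)"
  using assms
proof (induction "card (Pts X)" arbitrary: X I \<gamma> A B rule: less_induct)
  case less
  note X = less.prems(1) and A = less.prems(3) and B = less.prems(4)
    and t = less.prems(5) and compat = less.prems(6)
  have \<gamma>: "is_gmap G (\<gamma> l)" "Tgt (\<gamma> l) = X" "inj_on (Fun (\<gamma> l)) (Pts (Src (\<gamma> l)))"
    "transitive_gset G (Src (\<gamma> l))" if "l \<in> I" for l
    using less.prems(2) that unfolding orbit_cover_def by auto
  have covered: "\<exists>l\<in>I. x \<in> Fun (\<gamma> l) ` Pts (Src (\<gamma> l))" if "x \<in> Pts X" for x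
    using less.prems(2) that unfolding orbit_cover_def by blast
  have nonempty: "Fun (\<gamma> l) ` Pts (Src (\<gamma> l)) \<noteq> {}" if "l \<in> I" for l
    using \<gamma>(4)[OF that] unfolding transitive_gset_def by simp
  show ?case
  proof (cases "Pts X = {}")
    case True
    then have "I = {}"
      using gmap_Fun_Pts[OF \<gamma>(1)] \<gamma>(2) nonempty by blast
    then show ?thesis
      using arrows_over_empty[OF X True A B] by simp
  next
    case False
    then obtain l0 where l0: "l0 \<in> I"
      using covered by blast
    define im where "im l = Fun (\<gamma> l) ` Pts (Src (\<gamma> l))" for l
    define j where "j = inclusion_gmap G X (Pts X - im l0)"
    have cop: "gset_coproduct G (\<gamma> l0) j"
      using coproduct_with_complement[OF \<gamma>(1,3)[OF l0]] \<gamma>(2)[OF l0] unfolding j_def im_def by simp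
    then have j: "is_gmap G j" and inj_j: "inj_on (Fun j) (Pts (Src j))"
      unfolding gset_coproduct_def by auto
    have jX: "Tgt j = X" and im_j: "Fun j ` Pts (Src j) = Pts X - im l0"
      and Pts_j: "Pts (Src j) = Pts X - im l0"
      unfolding j_def inclusion_gmap_def by auto
    have X': "finite_gset G (Src j)"
      using j unfolding is_gmap_def by blast
    have im_X: "im l \<subseteq> Pts X" if "l \<in> I" for l
      using gmap_Fun_Pts[OF \<gamma>(1)[OF that]] \<gamma>(2)[OF that] unfolding im_def by blast
    have smaller: "card (Pts (Src j)) < card (Pts X)"
      unfolding Pts_j using im_X[OF l0] nonempty[OF l0] X unfolding finite_gset_def im_def
      by (intro psubset_card_mono) auto
    \<comment> \<open>Transitivity of the sources leaves two cases: the image of \<open>l\<close> avoids that of \<open>l0\<close>, or is contained in it.\<close>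
    define I' where "I' = {l \<in> I. im l \<inter> im l0 = {}}"
    have dichotomy: "im l \<subseteq> im l0" if "l \<in> I" "l \<notin> I'" for l
      using transitive_image_dichotomy[OF \<gamma>(1)[OF that(1)] \<gamma>(1)[OF l0] _ \<gamma>(4)[OF that(1)]]
        \<gamma>(2)[OF that(1)] \<gamma>(2)[OF l0] that unfolding I'_def im_def by auto
    have "\<exists>k. is_gmap G k \<and> Src k = Src (\<gamma> l) \<and> Tgt k = Src j \<and> comp_gmap j k = \<gamma> l" if "l \<in> I'" for l
    proof -
      have l: "l \<in> I" and "Fun (\<gamma> l) ` Pts (Src (\<gamma> l)) \<subseteq> Fun j ` Pts (Src j)"
        using that im_X unfolding I'_def im_j im_def by auto
      then show ?thesis
        using factor_through_injective[OF \<gamma>(1)[OF l] j _ inj_j] \<gamma>(2)[OF l] jX by metis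
    qed
    then obtain \<gamma>' where \<gamma>': "is_gmap G (\<gamma>' l)" "Src (\<gamma>' l) = Src (\<gamma> l)" "Tgt (\<gamma>' l) = Src j"
      "comp_gmap j (\<gamma>' l) = \<gamma> l" if "l \<in> I'" for l
      by metis
    have I'I: "l \<in> I" if "l \<in> I'" for l
      using that unfolding I'_def by blast
    have Fun_\<gamma>': "Fun (\<gamma> l) x = Fun j (Fun (\<gamma>' l) x)" if "l \<in> I'" "x \<in> Pts (Src (\<gamma> l))" for l x
      using comp_gmap_simps(3)[of x "\<gamma>' l" j] \<gamma>'[OF that(1)] that(2) by simp
    have "inj_on (Fun (\<gamma>' l)) (Pts (Src (\<gamma>' l)))" if l: "l \<in> I'" for l
      using \<gamma>(3)[OF I'I[OF l]] Fun_\<gamma>'[OF l] \<gamma>'(2)[OF l] unfolding inj_on_def by simp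
    moreover have "\<exists>l\<in>I'. x \<in> Fun (\<gamma>' l) ` Pts (Src (\<gamma>' l))" if x: "x \<in> Pts (Src j)" for x
    proof -
      have jx: "Fun j x \<in> Pts X - im l0"
        using im_j x by blast
      then obtain l where l: "l \<in> I" "Fun j x \<in> im l"
        using covered unfolding im_def by blast
      then have l': "l \<in> I'"
        using dichotomy jx by blast
      obtain y where y: "y \<in> Pts (Src (\<gamma> l))" "Fun j x = Fun j (Fun (\<gamma>' l) y)"
        using l(2) Fun_\<gamma>'[OF l'] unfolding im_def by auto
      then have "x = Fun (\<gamma>' l) y"
        using inj_onD[OF inj_j] x gmap_Fun_Pts[OF \<gamma>'(1)[OF l']] \<gamma>'(2,3)[OF l'] by simp
      then have "x \<in> Fun (\<gamma>' l) ` Pts (Src (\<gamma>' l))"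
        using y(1) \<gamma>'(2)[OF l'] by simp
      then show ?thesis
        using l' by blast
    qed
    ultimately have cover': "orbit_cover G (Src j) I' \<gamma>'"
      using \<gamma>' \<gamma>(4)[OF I'I] unfolding orbit_cover_def by simp
    have AB': "pull_ob D j A \<in> Ob (val D (Src j))" "pull_ob D j B \<in> Ob (val D (Src j))"
      using pull_Ob[OF j] A B jX by auto
    have pull_\<gamma>': "pull_ob D (\<gamma>' l) (pull_ob D j V) = pull_ob D (\<gamma> l) V"
      if "l \<in> I'" "V \<in> Ob (val D X)" for l V
      using pull_comp_gmap(1)[OF \<gamma>'(1)[OF that(1)] j] \<gamma>'[OF that(1)] that(2) jX by simp
    have t': "t l \<in> arrows (val D (Src (\<gamma>' l))) (pull_ob D (\<gamma>' l) (pull_ob D j A))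
        (pull_ob D (\<gamma>' l) (pull_ob D j B))" if "l \<in> I'" for l
      using t[OF I'I[OF that]] pull_\<gamma>'[OF that] A B \<gamma>'(2)[OF that] by simp
    have compat': "pull_ar D k (t l') = t l"
      if l: "l \<in> I'" "l' \<in> I'" and k: "is_gmap G k" "Src k = Src (\<gamma>' l)" "Tgt k = Src (\<gamma>' l')"
        and eq: "comp_gmap (\<gamma>' l') k = \<gamma>' l" for l l' k
    proof -
      have "comp_gmap (\<gamma> l') k = \<gamma> l"
        using comp_gmap_assoc[OF k(1), of "\<gamma>' l'" j] \<gamma>'(4)[OF l(1)] \<gamma>'(4)[OF l(2)] eq k(3) by simp
      then show ?thesis
        using compat[OF I'I[OF l(1)] I'I[OF l(2)] k(1)] k \<gamma>'(2)[OF l(1)] \<gamma>'(2)[OF l(2)] by simp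
    qed
    have "\<exists>!f. f \<in> arrows (val D (Src j)) (pull_ob D j A) (pull_ob D j B) \<and>
        (\<forall>l\<in>I'. pull_ar D (\<gamma>' l) f = t l)"
      by (rule less.hyps[OF smaller X' cover' AB' t' compat'])
    then obtain f' where f': "f' \<in> arrows (val D (Src j)) (pull_ob D j A) (pull_ob D j B)"
        "\<And>l. l \<in> I' \<Longrightarrow> pull_ar D (\<gamma>' l) f' = t l"
      and f'_unique: "\<And>f. f \<in> arrows (val D (Src j)) (pull_ob D j A) (pull_ob D j B) \<Longrightarrow>
        (\<And>l. l \<in> I' \<Longrightarrow> pull_ar D (\<gamma>' l) f = t l) \<Longrightarrow> f = f'"
      by (elim ex1E) blast
    have restrict_pull: "pull_ar D (\<gamma> l) f = pull_ar D (\<gamma>' l) (pull_ar D j f)"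
      if "l \<in> I'" "f \<in> arrows (val D X) A B" for l f
      using pull_comp_gmap(2)[OF \<gamma>'(1)[OF that(1)] j] \<gamma>'[OF that(1)] that(2) jX by simp
    have glue: "(\<forall>l\<in>I. pull_ar D (\<gamma> l) f = t l) \<longleftrightarrow> pull_ar D (\<gamma> l0) f = t l0 \<and> pull_ar D j f = f'"
      if f: "f \<in> arrows (val D X) A B" for f
    proof
      assume all: "\<forall>l\<in>I. pull_ar D (\<gamma> l) f = t l"
      have "pull_ar D j f = f'"
        using f'_unique[of "pull_ar D j f"] pull_arrows[OF j, of f A B] f jX all
          restrict_pull[OF _ f] I'I by simp
      then show "pull_ar D (\<gamma> l0) f = t l0 \<and> pull_ar D j f = f'"
        using all l0 by blast
    next
      assume both: "pull_ar D (\<gamma> l0) f = t l0 \<and> pull_ar D j f = f'"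
      have "pull_ar D (\<gamma> l) f = t l" if l: "l \<in> I" for l
      proof (cases "l \<in> I'")
        case True
        then show ?thesis
          using restrict_pull[OF True f] f'(2)[OF True] both by simp
      next
        case False
        obtain k where k: "is_gmap G k" "Src k = Src (\<gamma> l)" "Tgt k = Src (\<gamma> l0)"
          "comp_gmap (\<gamma> l0) k = \<gamma> l"
          using factor_through_injective[OF \<gamma>(1)[OF l] \<gamma>(1)[OF l0] _ \<gamma>(3)[OF l0]]
            dichotomy[OF l False] \<gamma>(2)[OF l] \<gamma>(2)[OF l0] unfolding im_def by metis
        have "pull_ar D (\<gamma> l) f = pull_ar D k (pull_ar D (\<gamma> l0) f)"
          using pull_comp_gmap(2)[OF k(1) \<gamma>(1)[OF l0]] k \<gamma>(2)[OF l0] f by simp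
        then show ?thesis
          using compat[OF l l0 k] both by simp
      qed
      then show "\<forall>l\<in>I. pull_ar D (\<gamma> l) f = t l" by blast
    qed
    have "\<exists>!f. f \<in> arrows (val D X) A B \<and> pull_ar D (\<gamma> l0) f = t l0 \<and> pull_ar D j f = f'"
      by (rule coproduct_arrows[OF cop \<gamma>(2)[OF l0] A B t[OF l0] f'(1)])
    moreover have "(f \<in> arrows (val D X) A B \<and> (\<forall>l\<in>I. pull_ar D (\<gamma> l) f = t l)) =
        (f \<in> arrows (val D X) A B \<and> pull_ar D (\<gamma> l0) f = t l0 \<and> pull_ar D j f = f')" for f
      using glue[of f] by blast
    ultimately show ?thesis
      by presburger
  qed
qed

lemma arrows_eq_on_orbits:
  assumes X: "finite_gset G X" and cover: "orbit_cover G X I \<gamma>"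
    and f: "f \<in> arrows (val D X) A B" and f': "f' \<in> arrows (val D X) A B"
    and eq: "\<And>l. l \<in> I \<Longrightarrow> pull_ar D (\<gamma> l) f = pull_ar D (\<gamma> l) f'"
  shows "f = f'"
proof -
  have \<gamma>: "is_gmap G (\<gamma> l)" "Tgt (\<gamma> l) = X" if "l \<in> I" for l
    using cover that unfolding orbit_cover_def by auto
  have AB: "A \<in> Ob (val D X)" "B \<in> Ob (val D X)"
    using arrows_Ob[OF category_val[OF X] f] by auto
  have "\<exists>!h. h \<in> arrows (val D X) A B \<and> (\<forall>l\<in>I. pull_ar D (\<gamma> l) h = pull_ar D (\<gamma> l) f)"
  proof (rule glue_arrows[OF X cover AB])
    show "pull_ar D (\<gamma> l) f \<in> arrows (val D (Src (\<gamma> l))) (pull_ob D (\<gamma> l) A) (pull_ob D (\<gamma> l) B)"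
      if "l \<in> I" for l
      using pull_arrows[OF \<gamma>(1)[OF that]] \<gamma>(2)[OF that] f by simp
    show "pull_ar D k (pull_ar D (\<gamma> l') f) = pull_ar D (\<gamma> l) f"
      if "l' \<in> I" "is_gmap G k" "Tgt k = Src (\<gamma> l')" "comp_gmap (\<gamma> l') k = \<gamma> l" for l l' k
      using pull_comp_gmap(2)[OF that(2) \<gamma>(1)[OF that(1)]] \<gamma>(2)[OF that(1)] f that by simp
  qed
  then show ?thesis
    using f f' eq by metis
qed

text \<open>The inverses of a compatible family are again compatible, because inverses are unique. The two glued
  arrows are then inverse to each other, since they are so on every orbit.\<close>

lemma glue_isos:
  assumes X: "finite_gset G X" and cover: "orbit_cover G X I \<gamma>"
    and A: "A \<in> Ob (val D X)" and B: "B \<in> Ob (val D X)"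
    and t: "\<And>l. l \<in> I \<Longrightarrow> iso_arrow (val D (Src (\<gamma> l))) (pull_ob D (\<gamma> l) A) (pull_ob D (\<gamma> l) B) (t l)"
    and compat: "\<And>l l' k. l \<in> I \<Longrightarrow> l' \<in> I \<Longrightarrow> is_gmap G k \<Longrightarrow> Src k = Src (\<gamma> l) \<Longrightarrow>
      Tgt k = Src (\<gamma> l') \<Longrightarrow> comp_gmap (\<gamma> l') k = \<gamma> l \<Longrightarrow> pull_ar D k (t l') = t l"
  shows "\<exists>f. iso_arrow (val D X) A B f \<and> (\<forall>l\<in>I. pull_ar D (\<gamma> l) f = t l)"
proof -
  have \<gamma>: "is_gmap G (\<gamma> l)" "Tgt (\<gamma> l) = X" "category (val D (Src (\<gamma> l)))" if "l \<in> I" for l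
    using cover that category_val unfolding orbit_cover_def is_gmap_def by auto
  have "\<forall>l\<in>I. \<exists>u. iso_arrow (val D (Src (\<gamma> l))) (pull_ob D (\<gamma> l) B) (pull_ob D (\<gamma> l) A) u \<and>
      u \<cdot>\<^bsub>val D (Src (\<gamma> l))\<^esub> t l = Idn (val D (Src (\<gamma> l))) (pull_ob D (\<gamma> l) A) \<and>
      t l \<cdot>\<^bsub>val D (Src (\<gamma> l))\<^esub> u = Idn (val D (Src (\<gamma> l))) (pull_ob D (\<gamma> l) B)"
    using t iso_arrow_inverseE by metis
  then obtain u where u: "iso_arrow (val D (Src (\<gamma> l))) (pull_ob D (\<gamma> l) B) (pull_ob D (\<gamma> l) A) (u l)"
    "u l \<cdot>\<^bsub>val D (Src (\<gamma> l))\<^esub> t l = Idn (val D (Src (\<gamma> l))) (pull_ob D (\<gamma> l) A)"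
    "t l \<cdot>\<^bsub>val D (Src (\<gamma> l))\<^esub> u l = Idn (val D (Src (\<gamma> l))) (pull_ob D (\<gamma> l) B)" if "l \<in> I" for l
    by metis
  obtain f where f: "f \<in> arrows (val D X) A B" and ft: "\<And>l. l \<in> I \<Longrightarrow> pull_ar D (\<gamma> l) f = t l"
    using ex1_implies_ex[OF glue_arrows[OF X cover A B iso_arrowD[OF t] compat]] by blast
  have compat_u: "pull_ar D k (u l') = u l"
    if l: "l \<in> I" "l' \<in> I" and k: "is_gmap G k" "Src k = Src (\<gamma> l)" "Tgt k = Src (\<gamma> l')"
      and eq: "comp_gmap (\<gamma> l') k = \<gamma> l" for l l' k
  proof -
    have pull: "pull_ob D k (pull_ob D (\<gamma> l') V) = pull_ob D (\<gamma> l) V" if "V \<in> Ob (val D X)" for V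
      using pull_comp_gmap(1)[OF k(1) \<gamma>(1)[OF l(2)]] \<gamma>(2)[OF l(2)] eq k(3) that by simp
    have ku: "pull_ar D k (u l') \<in> arrows (val D (Src (\<gamma> l))) (pull_ob D (\<gamma> l) B) (pull_ob D (\<gamma> l) A)"
      using pull_arrows[OF k(1), unfolded k(2,3), OF iso_arrowD[OF u(1)[OF l(2)]]]
      unfolding pull[OF A] pull[OF B] .
    have A': "pull_ob D (\<gamma> l') A \<in> Ob (val D (Src (\<gamma> l')))"
      using pull_Ob[OF \<gamma>(1)[OF l(2)], unfolded \<gamma>(2)[OF l(2)], OF A] .
    have "pull_ar D k (u l') \<cdot>\<^bsub>val D (Src (\<gamma> l))\<^esub> t l =
        Idn (val D (Src (\<gamma> l))) (pull_ob D (\<gamma> l) A)"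
      using pull_cmp[OF k(1), unfolded k(2,3), OF iso_arrowD[OF t[OF l(2)]] iso_arrowD[OF u(1)[OF l(2)]]]
      unfolding u(2)[OF l(2)] functor_id[OF pull_functor[OF k(1)], unfolded k(2,3), OF A']
        compat[OF l k eq] pull[OF A] by simp
    then show ?thesis
      using iso_cancel_right[OF \<gamma>(3)[OF l(1)] t[OF l(1)] ku iso_arrowD[OF u(1)[OF l(1)]]] u(2)[OF l(1)]
      by simp
  qed
  obtain f' where f': "f' \<in> arrows (val D X) B A" and f'u: "\<And>l. l \<in> I \<Longrightarrow> pull_ar D (\<gamma> l) f' = u l"
    using ex1_implies_ex[OF glue_arrows[OF X cover B A iso_arrowD[OF u(1)] compat_u]] by blast
  note C = category_val[OF X]
  have "f' \<cdot>\<^bsub>val D X\<^esub> f = Idn (val D X) A"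
  proof (rule arrows_eq_on_orbits[OF X cover comp_arrows[OF C f f'] id_arrows[OF C A]])
    show "pull_ar D (\<gamma> l) (f' \<cdot>\<^bsub>val D X\<^esub> f) = pull_ar D (\<gamma> l) (Idn (val D X) A)" if "l \<in> I" for l
      using functor_id[OF pull_functor[OF \<gamma>(1)[OF that]]] pull_cmp[OF \<gamma>(1)[OF that]] f f' A
        \<gamma>(2)[OF that] ft[OF that] f'u[OF that] u(2)[OF that] by simp
  qed
  moreover have "f \<cdot>\<^bsub>val D X\<^esub> f' = Idn (val D X) B"
  proof (rule arrows_eq_on_orbits[OF X cover comp_arrows[OF C f' f] id_arrows[OF C B]])
    show "pull_ar D (\<gamma> l) (f \<cdot>\<^bsub>val D X\<^esub> f') = pull_ar D (\<gamma> l) (Idn (val D X) B)" if "l \<in> I" for l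
      using functor_id[OF pull_functor[OF \<gamma>(1)[OF that]]] pull_cmp[OF \<gamma>(1)[OF that]] f f' B
        \<gamma>(2)[OF that] ft[OF that] f'u[OF that] u(3)[OF that] by simp
  qed
  ultimately show ?thesis
    using f f' ft unfolding iso_arrow_def by blast
qed

end

section \<open>The orbits of the fibre powers of a coset space\<close>

locale coset_cover = gset_sheaf G D
  for G :: "('g, 'z) monoid_scheme" (structure) and D :: "('g, 'a, 'o, 'm) presheaf" +
  fixes H
  assumes finite_carrier: "finite (carrier G)" and H: "subgroup H G"
begin

lemma H_carrier [simp]: "h \<in> H \<Longrightarrow> h \<in> carrier G"
  using subgroup.mem_carrier[OF H] .

lemma mem_cap1: "g \<in> carrier G \<Longrightarrow> x \<in> cap1 G H g \<longleftrightarrow> x \<in> H \<and> g \<otimes> x \<otimes> inv g \<in> H"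
  unfolding cap1_def using mem_conj_sub_iff[OF subgroup.subset[OF H]] by auto

lemma mem_cap2:
  "g1 \<in> carrier G \<Longrightarrow> g2 \<in> carrier G \<Longrightarrow> x \<in> cap2 G H g2 g1 \<longleftrightarrow>
   x \<in> H \<and> g1 \<otimes> x \<otimes> inv g1 \<in> H \<and> (g2 \<otimes> g1) \<otimes> x \<otimes> inv (g2 \<otimes> g1) \<in> H"
  unfolding cap2_def using mem_conj_sub_iff[OF subgroup.subset[OF H]] by auto

lemma subgroup_cap1: "g \<in> carrier G \<Longrightarrow> subgroup (cap1 G H g) G"
  unfolding cap1_def using subgroups_Inter_pair subgroup_conj_sub[OF H] H by blast

lemma subgroup_cap2: "g1 \<in> carrier G \<Longrightarrow> g2 \<in> carrier G \<Longrightarrow> subgroup (cap2 G H g2 g1) G"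
  unfolding cap2_def using subgroups_Inter_pair subgroup_conj_sub[OF H] H by blast

abbreviation cover :: "('g, 'a) gmap" where
  "cover \<equiv> beta_gmap G H (carrier G) \<one>"

abbreviation \<beta>1 :: "'g \<Rightarrow> 'g \<Rightarrow> ('g, 'a) gmap" where
  "\<beta>1 g x \<equiv> beta_gmap G (cap1 G H g) H x"

abbreviation \<beta>2 :: "'g \<Rightarrow> 'g \<Rightarrow> 'g \<Rightarrow> ('g, 'a) gmap" where
  "\<beta>2 g2 g1 x \<equiv> beta_gmap G (cap2 G H g2 g1) H x"

text \<open>The order of the components is the one for which \<open>(\<gamma> g)\<^sup>*\<close> takes an arrow \<open>pr\<^sub>2\<^sup>* W \<rightarrow> pr\<^sub>1\<^sup>* W\<close> to an arrow
  \<open>\<beta>\<^sub>1\<^sup>* W \<rightarrow> \<beta>\<^sub>g\<^sup>* W\<close>, and for which the projections \<open>pr\<^sub>1\<^sub>2\<close>, \<open>pr\<^sub>1\<^sub>3\<close>, \<open>pr\<^sub>2\<^sub>3\<close> of \<open>\<delta> g2 g1\<close> are \<open>\<gamma> g2\<close>, \<open>\<gamma> (g2 g1)\<close>, \<open>\<gamma> g1\<close>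
  preceded by maps of coset spaces.\<close>

abbreviation \<gamma> :: "'g \<Rightarrow> ('g, 'a) gmap" where
  "\<gamma> g \<equiv> pair_gmap G cover (\<beta>1 g g) (\<beta>1 g \<one>)"

abbreviation \<delta> :: "'g \<Rightarrow> 'g \<Rightarrow> ('g, 'a) gmap" where
  "\<delta> g2 g1 \<equiv> triple_gmap G cover (\<beta>2 g2 g1 (g2 \<otimes> g1)) (\<beta>2 g2 g1 g1) (\<beta>2 g2 g1 \<one>)"

lemma conjugates_into_carrier:
  "subgroup K G \<Longrightarrow> g \<in> carrier G \<Longrightarrow> conjugates_into G g K (carrier G)"
  unfolding conjugates_into_def by (simp add: subgroup.mem_carrier)

lemma conjugates_into_H:
  assumes g: "g \<in> carrier G"
  shows "conjugates_into G g (cap1 G H g) H" "conjugates_into G \<one> (cap1 G H g) H"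
  unfolding conjugates_into_def using mem_cap1[OF g] by auto

lemma conjugates_into_H2:
  assumes g: "g1 \<in> carrier G" "g2 \<in> carrier G"
  shows "conjugates_into G (g2 \<otimes> g1) (cap2 G H g2 g1) H" "conjugates_into G g1 (cap2 G H g2 g1) H"
    "conjugates_into G \<one> (cap2 G H g2 g1) H"
  unfolding conjugates_into_def using mem_cap2[OF g] by auto

lemma conjugates_into_cap1:
  assumes g: "g1 \<in> carrier G" "g2 \<in> carrier G"
  shows "conjugates_into G \<one> (cap2 G H g2 g1) (cap1 G H (g2 \<otimes> g1))"
    "conjugates_into G g1 (cap2 G H g2 g1) (cap1 G H g2)"
    "conjugates_into G \<one> (cap2 G H g2 g1) (cap1 G H g1)"
  unfolding conjugates_into_def using mem_cap2[OF g] mem_cap1 g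
  by (auto simp: group_normalize)

lemmas is_gmap_\<beta> = is_gmap_beta[OF finite_carrier]

lemma is_gmap_cover: "is_gmap G cover"
  by (simp add: is_gmap_\<beta>[OF H subgroup_self] conjugates_into_carrier[OF H])

lemma cover_constant:
  assumes "x \<in> Pts (coset_gset G H)" "y \<in> Pts (coset_gset G H)"
  shows "Fun cover x = Fun cover y"
proof -
  have "Fun cover (Coset (z <# H)) = Coset (\<one> <# carrier G)" if "z \<in> carrier G" for z
    using that lcoset_eq_iff[OF subgroup_self, of z \<one>]
    by (simp add: Fun_beta_gmap[OF H subgroup_self _ conjugates_into_carrier[OF H]])
  then show ?thesis
    using assms unfolding Pts_coset_gset by auto
qed

lemma gmaps_over_cover:
  assumes "is_gmap G a" "is_gmap G b" "is_gmap G d" "Src b = Src a" "Src d = Src a"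
    and "Tgt a = coset_gset G H" "Tgt b = coset_gset G H" "Tgt d = coset_gset G H"
  shows "gmaps_over G cover a b d"
proof -
  have "Fun a x \<in> Pts (coset_gset G H)" "Fun b x \<in> Pts (coset_gset G H)"
    "Fun d x \<in> Pts (coset_gset G H)" if "x \<in> Pts (Src a)" for x
    using gmap_Fun_Pts[OF assms(1)] gmap_Fun_Pts[OF assms(2)] gmap_Fun_Pts[OF assms(3)] assms that
    by simp_all
  then show ?thesis
    using assms is_gmap_cover by unfold_locales (auto intro: cover_constant)
qed

lemma gmaps_over_\<gamma>: "g \<in> carrier G \<Longrightarrow> gmaps_over G cover (\<beta>1 g g) (\<beta>1 g \<one>) (\<beta>1 g \<one>)"
  by (rule gmaps_over_cover)
    (simp_all add: is_gmap_\<beta>[OF subgroup_cap1 H] conjugates_into_H)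

lemma gmaps_over_\<delta>:
  "g1 \<in> carrier G \<Longrightarrow> g2 \<in> carrier G \<Longrightarrow>
   gmaps_over G cover (\<beta>2 g2 g1 (g2 \<otimes> g1)) (\<beta>2 g2 g1 g1) (\<beta>2 g2 g1 \<one>)"
  by (rule gmaps_over_cover)
    (simp_all add: is_gmap_\<beta>[OF subgroup_cap2 H] conjugates_into_H2)

lemmas is_gmap_\<gamma> = gmaps_over.is_gmap_pair[OF gmaps_over_\<gamma>]
lemmas pr_\<gamma> = gmaps_over.pr_pair[OF gmaps_over_\<gamma>]
lemmas is_gmap_\<delta> = gmaps_over.is_gmap_triple[OF gmaps_over_\<delta>]

text \<open>The maps of coset spaces on the right are exactly those along which condition (ii) pulls back
  \<open>s\<close>. This translates the cocycle condition over \<open>U\<^sup>3\<close> into (ii).\<close>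

lemma pr_\<delta>:
  assumes g: "g1 \<in> carrier G" "g2 \<in> carrier G"
  shows "comp_gmap (pr12 G cover) (\<delta> g2 g1) =
      comp_gmap (\<gamma> g2) (beta_gmap G (cap2 G H g2 g1) (cap1 G H g2) g1)"
    "comp_gmap (pr13 G cover) (\<delta> g2 g1) =
      comp_gmap (\<gamma> (g2 \<otimes> g1)) (beta_gmap G (cap2 G H g2 g1) (cap1 G H (g2 \<otimes> g1)) \<one>)"
    "comp_gmap (pr23 G cover) (\<delta> g2 g1) =
      comp_gmap (\<gamma> g1) (beta_gmap G (cap2 G H g2 g1) (cap1 G H g1) \<one>)"
  using g conjugates_into_cap1[OF g]
  by (simp_all add: is_gmap_\<beta>[OF subgroup_cap2 subgroup_cap1] gmaps_over.pr_triple[OF gmaps_over_\<delta>] pair_comp_gmap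
      comp_beta_gmap[OF finite_carrier subgroup_cap2 subgroup_cap1 H] conjugates_into_H)

lemma Fun_\<gamma>:
  "g \<in> carrier G \<Longrightarrow> x \<in> carrier G \<Longrightarrow>
   Fun (\<gamma> g) (Coset (x <# cap1 G H g)) = Pt_Pair (Coset ((x \<otimes> inv g) <# H)) (Coset (x <# H))"
  by (subst tuple_gmap_simps)
    (auto simp: Pts_coset_gset Fun_beta_gmap[OF subgroup_cap1 H] conjugates_into_H)

lemma Fun_\<delta>:
  "g1 \<in> carrier G \<Longrightarrow> g2 \<in> carrier G \<Longrightarrow> x \<in> carrier G \<Longrightarrow>
   Fun (\<delta> g2 g1) (Coset (x <# cap2 G H g2 g1)) =
     Pt_Pair (Coset ((x \<otimes> inv (g2 \<otimes> g1)) <# H))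
       (Pt_Pair (Coset ((x \<otimes> inv g1) <# H)) (Coset (x <# H)))"
  by (subst tuple_gmap_simps)
    (auto simp: Pts_coset_gset Fun_beta_gmap[OF subgroup_cap2 H] conjugates_into_H2)

text \<open>Injectivity says that the stabilizer of \<open>([g\<^sup>-\<^sup>1], [1])\<close> is \<open>H[g]\<close> and not larger.\<close>

lemma inj_\<gamma>:
  assumes g: "g \<in> carrier G"
  shows "inj_on (Fun (\<gamma> g)) (Pts (coset_gset G (cap1 G H g)))"
proof (rule inj_onI)
  note K = subgroup_cap1[OF g]
  fix p q assume p: "p \<in> Pts (coset_gset G (cap1 G H g))" and q: "q \<in> Pts (coset_gset G (cap1 G H g))"
    and eq: "Fun (\<gamma> g) p = Fun (\<gamma> g) q"
  obtain x y where x: "x \<in> carrier G" "p = Coset (x <# cap1 G H g)"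
    and y: "y \<in> carrier G" "q = Coset (y <# cap1 G H g)"
    using p q unfolding Pts_coset_gset by blast
  have "(x \<otimes> inv g) <# H = (y \<otimes> inv g) <# H" "x <# H = y <# H"
    using eq g x(1) y(1) unfolding x(2) y(2) by (simp_all add: Fun_\<gamma>)
  then have "inv x \<otimes> y \<in> cap1 G H g"
    unfolding mem_cap1[OF g] using g x(1) y(1) by (simp add: lcoset_eq_iff[OF H] group_normalize)
  then show "p = q"
    unfolding x y using lcoset_eq_iff[OF K] x(1) y(1) by simp
qed

lemma inj_\<delta>:
  assumes g: "g1 \<in> carrier G" "g2 \<in> carrier G"
  shows "inj_on (Fun (\<delta> g2 g1)) (Pts (coset_gset G (cap2 G H g2 g1)))"
proof (rule inj_onI)
  note K = subgroup_cap2[OF g]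
  fix p q assume p: "p \<in> Pts (coset_gset G (cap2 G H g2 g1))"
    and q: "q \<in> Pts (coset_gset G (cap2 G H g2 g1))"
    and eq: "Fun (\<delta> g2 g1) p = Fun (\<delta> g2 g1) q"
  obtain x y where x: "x \<in> carrier G" "p = Coset (x <# cap2 G H g2 g1)"
    and y: "y \<in> carrier G" "q = Coset (y <# cap2 G H g2 g1)"
    using p q unfolding Pts_coset_gset by blast
  have "(x \<otimes> inv (g2 \<otimes> g1)) <# H = (y \<otimes> inv (g2 \<otimes> g1)) <# H"
    "(x \<otimes> inv g1) <# H = (y \<otimes> inv g1) <# H" "x <# H = y <# H"
    using eq g x(1) y(1) unfolding x(2) y(2) by (simp_all add: Fun_\<delta>)
  then have "inv x \<otimes> y \<in> cap2 G H g2 g1"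
    unfolding mem_cap2[OF g] using g x(1) y(1) by (simp add: lcoset_eq_iff[OF H] group_normalize)
  then show "p = q"
    unfolding x y using lcoset_eq_iff[OF K] x(1) y(1) by simp
qed

text \<open>The point \<open>([x], [y])\<close> is \<open>y\<close> times the base point \<open>([g\<^sup>-\<^sup>1], [1])\<close> for \<open>g = x\<^sup>-\<^sup>1 y\<close>.\<close>

lemma \<gamma>_jointly_surjective:
  assumes "p \<in> Pts (fibre2 G cover)"
  shows "\<exists>g\<in>carrier G. p \<in> Fun (\<gamma> g) ` Pts (coset_gset G (cap1 G H g))"
proof -
  obtain x y where x: "x \<in> carrier G" and y: "y \<in> carrier G"
    and p: "p = Pt_Pair (Coset (x <# H)) (Coset (y <# H))"
    using assms unfolding Pts_fibre2 by (auto simp: Pts_coset_gset)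
  let ?g = "inv x \<otimes> y"
  have "p = Fun (\<gamma> ?g) (Coset (y <# cap1 G H ?g))"
    unfolding p by (subst Fun_\<gamma>) (use x y in \<open>simp_all add: group_normalize\<close>)
  then have "p \<in> Fun (\<gamma> ?g) ` Pts (coset_gset G (cap1 G H ?g))"
    by (rule image_eqI) (use y in \<open>auto simp: Pts_coset_gset\<close>)
  moreover have "?g \<in> carrier G"
    using x y by simp
  ultimately show ?thesis
    by blast
qed

text \<open>Solving \<open>[z g\<^sub>1\<^sup>-\<^sup>1] = [y]\<close> and \<open>[z (g\<^sub>2 g\<^sub>1)\<^sup>-\<^sup>1] = [x]\<close> suggests \<open>g\<^sub>1 = y\<^sup>-\<^sup>1 z\<close> and \<open>g\<^sub>2 = x\<^sup>-\<^sup>1 y\<close>.\<close>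

lemma \<delta>_jointly_surjective:
  assumes "p \<in> Pts (fibre3 G cover)"
  shows "\<exists>g1\<in>carrier G. \<exists>g2\<in>carrier G. p \<in> Fun (\<delta> g2 g1) ` Pts (coset_gset G (cap2 G H g2 g1))"
proof -
  obtain x y z where x: "x \<in> carrier G" and y: "y \<in> carrier G" and z: "z \<in> carrier G"
    and p: "p = Pt_Pair (Coset (x <# H)) (Pt_Pair (Coset (y <# H)) (Coset (z <# H)))"
    using assms unfolding Pts_fibre3 by (auto simp: Pts_coset_gset)
  let ?g1 = "inv y \<otimes> z" and ?g2 = "inv x \<otimes> y"
  have "p = Fun (\<delta> ?g2 ?g1) (Coset (z <# cap2 G H ?g2 ?g1))"
    unfolding p by (subst Fun_\<delta>) (use x y z in \<open>simp_all add: group_normalize\<close>)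
  then have "p \<in> Fun (\<delta> ?g2 ?g1) ` Pts (coset_gset G (cap2 G H ?g2 ?g1))"
    by (rule image_eqI) (use z in \<open>auto simp: Pts_coset_gset\<close>)
  moreover have "?g1 \<in> carrier G" "?g2 \<in> carrier G"
    using x y z by simp_all
  ultimately show ?thesis
    by blast
qed

text \<open>If \<open>k\<close> sends the base point to \<open>[y]\<close>, comparing the images of the base point in \<open>U\<^sup>2\<close> gives \<open>y \<in> H\<close> and
  \<open>g y g'\<^sup>-\<^sup>1 \<in> H\<close>. These two elements put \<open>g\<close> into the double coset \<open>H g' H\<close>, and \<open>k\<close> is \<open>\<beta>\<^sub>u\<close> for \<open>u = y\<^sup>-\<^sup>1\<close>.\<close>

lemma \<gamma>_factorization:
  assumes g: "g \<in> carrier G" and g': "g' \<in> carrier G" and k: "is_gmap G k"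
    and src: "Src k = coset_gset G (cap1 G H g)" and tgt: "Tgt k = coset_gset G (cap1 G H g')"
    and eq: "comp_gmap (\<gamma> g') k = \<gamma> g"
  obtains h u where "h \<in> H" "u \<in> H" "g = h \<otimes> (g' \<otimes> u)"
    "k = beta_gmap G (cap1 G H g) (cap1 G H g') u"
proof -
  note K = subgroup_cap1[OF g] and K' = subgroup_cap1[OF g']
  have base: "(Coset (\<one> <# cap1 G H g) :: ('g, 'a) point) \<in> Pts (coset_gset G (cap1 G H g))"
    unfolding Pts_coset_gset by blast
  then have "Fun k (Coset (\<one> <# cap1 G H g)) \<in> Pts (coset_gset G (cap1 G H g'))"
    using gmap_Fun_Pts[OF k] src tgt by simp
  then obtain y where y: "y \<in> carrier G" and ky: "Fun k (Coset (\<one> <# cap1 G H g)) = Coset (y <# cap1 G H g')"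
    unfolding Pts_coset_gset by blast
  have "Fun (\<gamma> g') (Coset (y <# cap1 G H g')) = Fun (\<gamma> g) (Coset (\<one> <# cap1 G H g))"
    using arg_cong[OF eq, of "\<lambda>a. Fun a (Coset (\<one> <# cap1 G H g))"] base src ky by simp
  then have "(\<one> \<otimes> inv g) <# H = (y \<otimes> inv g') <# H" "\<one> <# H = y <# H"
    using g g' y by (simp_all add: Fun_\<gamma> del: l_one)
  then have yH: "y \<in> H" and hH: "g \<otimes> (y \<otimes> inv g') \<in> H"
    using g g' y by (simp_all add: lcoset_eq_iff[OF H])
  define h u where "h = g \<otimes> (y \<otimes> inv g')" and "u = inv y"
  have h: "h \<in> H" and u: "u \<in> H"
    unfolding h_def u_def using hH subgroup.m_inv_closed[OF H yH] by auto
  have geq: "g = h \<otimes> (g' \<otimes> u)"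
    unfolding h_def u_def using g g' y by (simp add: group_normalize)
  have "u \<otimes> z \<otimes> inv u \<in> cap1 G H g'" if "z \<in> cap1 G H g" for z
  proof -
    have z: "z \<in> H" "g \<otimes> z \<otimes> inv g \<in> H"
      using that mem_cap1[OF g] by auto
    have "inv h \<otimes> (g \<otimes> z \<otimes> inv g) \<otimes> h \<in> H"
      using z(2) h subgroup.m_closed[OF H] subgroup.m_inv_closed[OF H] by simp
    moreover have "inv h \<otimes> (g \<otimes> z \<otimes> inv g) \<otimes> h = g' \<otimes> (u \<otimes> z \<otimes> inv u) \<otimes> inv g'"
      using h u g' z(1) by (simp add: geq group_normalize)
    moreover have "u \<otimes> z \<otimes> inv u \<in> H"
      using z(1) u subgroup.m_closed[OF H] subgroup.m_inv_closed[OF H] by simp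
    ultimately show ?thesis
      unfolding mem_cap1[OF g'] by simp
  qed
  then have cu: "conjugates_into G u (cap1 G H g) (cap1 G H g')"
    unfolding conjugates_into_def by blast
  have uG: "u \<in> carrier G" using u by simp
  have "Fun k (Coset (\<one> <# cap1 G H g)) =
      Fun (beta_gmap G (cap1 G H g) (cap1 G H g') u) (Coset (\<one> <# cap1 G H g))"
    unfolding Fun_beta_gmap[OF K K' uG cu one_closed] ky using y by (simp add: u_def)
  then have "k = beta_gmap G (cap1 G H g) (cap1 G H g') u"
    using gmap_from_coset_eqI[OF K k is_gmap_\<beta>[OF K K' uG cu]] src tgt by simp
  then show thesis
    using that h u geq by blast
qed

end

section \<open>Descent along a coset space in terms of cosets\<close>

text \<open>Every point of \<open>G/G\<close> has stabilizer \<open>G\<close>, and lies below the base point of \<open>G/H\<close>, whose stabilizer is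
  \<open>H\<close>.\<close>

lemma (in group) sipp_cover_coset:
  assumes fin: "finite (carrier G)" and H: "subgroup H G"
    and index: "coprime (sub_index G (carrier G) H) p"
  shows "sipp_cover G p (beta_gmap G H (carrier G) \<one> :: ('a, 'p) gmap)"
proof -
  let ?\<alpha> = "beta_gmap G H (carrier G) \<one> :: ('a, 'p) gmap"
  have into: "conjugates_into G \<one> H (carrier G)"
    unfolding conjugates_into_def using subgroup.mem_carrier[OF H] by simp
  have \<alpha>: "is_gmap G ?\<alpha>"
    using is_gmap_beta[OF fin H subgroup_self one_closed into] .
  have "\<exists>u\<in>Pts (Src ?\<alpha>). Fun ?\<alpha> u = x \<and>
      coprime (sub_index G (stabilizer G (Act (Tgt ?\<alpha>)) x) (stabilizer G (Act (Src ?\<alpha>)) u)) p"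
    if "x \<in> Pts (Tgt ?\<alpha>)" for x
  proof -
    obtain z where z: "z \<in> carrier G" and x: "x = Coset (z <# carrier G)"
      using \<open>x \<in> Pts (Tgt ?\<alpha>)\<close> by (auto simp: Pts_coset_gset)
    let ?u = "Coset (\<one> <# H) :: ('a, 'p) point"
    have u: "?u \<in> Pts (Src ?\<alpha>)"
      by (auto simp: Pts_coset_gset)
    have "Fun ?\<alpha> ?u = x"
      using z by (simp add: x Fun_beta_gmap[OF H subgroup_self one_closed into]
          lcoset_eq_iff[OF subgroup_self])
    moreover have "stabilizer G (Act (Tgt ?\<alpha>)) x = carrier G"
      using z by (auto simp: x stabilizer_def Act_coset_gset[OF subgroup_self]
          lcoset_eq_iff[OF subgroup_self])
    moreover have "inv g \<in> H \<longleftrightarrow> g \<in> H" if "g \<in> carrier G" for g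
      using subgroup.m_inv_closed[OF H, of g] subgroup.m_inv_closed[OF H, of "inv g"] that by auto
    then have "stabilizer G (Act (Src ?\<alpha>)) ?u = H"
      using subgroup.mem_carrier[OF H]
      by (auto simp: stabilizer_def Act_coset_gset[OF H] lcoset_eq_iff[OF H])
    ultimately show ?thesis
      using u index by (intro bexI[OF _ u]) simp
  qed
  then show ?thesis
    unfolding sipp_cover_def using \<alpha> by blast
qed

locale coset_descent = coset_cover G D H
  for G :: "('g, 'z) monoid_scheme" (structure) and D :: "('g, 'a, 'o, 'm) presheaf" and H +
  assumes descent: "equivalence_functor (val D (coset_gset G (carrier G)))
    (descent_cat G D (beta_gmap G H (carrier G) \<one>)) (descent_functor G D (beta_gmap G H (carrier G) \<one>))"
begin

abbreviation X0 :: "('g, 'a) gset" where "X0 \<equiv> coset_gset G (carrier G)"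
abbreviation U :: "('g, 'a) gset" where "U \<equiv> coset_gset G H"
abbreviation U2 :: "('g, 'a) gset" where "U2 \<equiv> fibre2 G cover"
abbreviation U3 :: "('g, 'a) gset" where "U3 \<equiv> fibre3 G cover"

definition coset_invariant :: "'m \<Rightarrow> bool" where
  "coset_invariant f \<longleftrightarrow> (\<forall>g\<in>carrier G. pull_ar D (\<beta>1 g \<one>) f = pull_ar D (\<beta>1 g g) f)"

lemma finite_gsets: "finite_gset G X0" "finite_gset G U" "finite_gset G U2" "finite_gset G U3"
  using finite_gset_coset[OF finite_carrier] H subgroup_self finite_gset_fibre2[OF is_gmap_cover]
    finite_gset_fibre3[OF is_gmap_cover] by simp_all

lemma finite_gset_cap1: "g \<in> carrier G \<Longrightarrow> finite_gset G (coset_gset G (cap1 G H g) :: ('g, 'a) gset)"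
  using finite_gset_coset[OF finite_carrier subgroup_cap1] .

lemma is_gmap_\<beta>1:
  assumes "g \<in> carrier G"
  shows "is_gmap G (\<beta>1 g g)" "is_gmap G (\<beta>1 g \<one>)"
  using is_gmap_\<beta>[OF subgroup_cap1[OF assms] H _ conjugates_into_H(1)[OF assms] ]
    is_gmap_\<beta>[OF subgroup_cap1[OF assms] H _ conjugates_into_H(2)[OF assms]] assms by simp_all

lemmas is_gmap_pr = is_gmap_projections[OF is_gmap_cover]

lemma orbit_cover_U2: "orbit_cover G U2 (carrier G) \<gamma>"
  unfolding orbit_cover_def
  using is_gmap_\<gamma> inj_\<gamma> \<gamma>_jointly_surjective
  by (simp add: transitive_coset_gset[OF subgroup_cap1])

lemma orbit_cover_U3: "orbit_cover G U3 (carrier G \<times> carrier G) (\<lambda>(g2, g1). \<delta> g2 g1)"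
proof -
  have "\<exists>l\<in>carrier G \<times> carrier G. p \<in> Fun (case l of (g2, g1) \<Rightarrow> \<delta> g2 g1) `
      Pts (Src (case l of (g2, g1) \<Rightarrow> \<delta> g2 g1))" if p: "p \<in> Pts U3" for p
  proof -
    obtain g1 g2 where "g1 \<in> carrier G" "g2 \<in> carrier G"
      "p \<in> Fun (\<delta> g2 g1) ` Pts (coset_gset G (cap2 G H g2 g1))"
      using \<delta>_jointly_surjective[OF p] by blast
    then show ?thesis
      by (intro bexI[where x = "(g2, g1)"]) (simp_all del: tuple_gmap_simps(6))
  qed
  then show ?thesis
    unfolding orbit_cover_def
    using is_gmap_\<delta> inj_\<delta> by (auto simp: transitive_coset_gset[OF subgroup_cap2])
qed

text \<open>\<open>G/G\<close> has only one point, so any two maps into \<open>U\<close> agree over it.\<close>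

lemma pull_cover_eq:
  assumes a: "is_gmap G a" "Tgt a = U" and b: "is_gmap G b" "Tgt b = U" and ab: "Src a = Src b"
    and V: "V \<in> Ob (val D X0)"
  shows "pull_ob D a (pull_ob D cover V) = pull_ob D b (pull_ob D cover V)"
proof -
  have "comp_gmap cover a = comp_gmap cover b"
    by (rule gmap_eqI[OF is_gmap_comp is_gmap_comp])
      (use a b ab is_gmap_cover gmap_Fun_Pts[OF a(1)] gmap_Fun_Pts[OF b(1)] in
        \<open>auto intro!: cover_constant\<close>)
  then show ?thesis
    using pull_comp_gmap(1)[OF a(1) is_gmap_cover] pull_comp_gmap(1)[OF b(1) is_gmap_cover] a b V
    by simp
qed

lemma pull_\<gamma>_pr_ob:
  assumes g: "g \<in> carrier G" and W: "W \<in> Ob (val D U)"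
  shows "pull_ob D (\<gamma> g) (pull_ob D (pr1 G cover) W) = pull_ob D (\<beta>1 g g) W"
    "pull_ob D (\<gamma> g) (pull_ob D (pr2 G cover) W) = pull_ob D (\<beta>1 g \<one>) W"
  using pull_comp_gmap(1)[OF is_gmap_\<gamma>[OF g] is_gmap_pr(1), of W]
    pull_comp_gmap(1)[OF is_gmap_\<gamma>[OF g] is_gmap_pr(2), of W] pr_\<gamma>[OF g] W by simp_all

lemma pull_\<gamma>_pr_ar:
  assumes g: "g \<in> carrier G" and f: "f \<in> arrows (val D U) W W'"
  shows "pull_ar D (\<gamma> g) (pull_ar D (pr1 G cover) f) = pull_ar D (\<beta>1 g g) f"
    "pull_ar D (\<gamma> g) (pull_ar D (pr2 G cover) f) = pull_ar D (\<beta>1 g \<one>) f"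
  using pull_comp_gmap(2)[OF is_gmap_\<gamma>[OF g] is_gmap_pr(1), of f W W']
    pull_comp_gmap(2)[OF is_gmap_\<gamma>[OF g] is_gmap_pr(2), of f W W'] pr_\<gamma>[OF g] f by simp_all

text \<open>An equality of arrows over \<open>U\<^sup>2\<close> can be tested along the \<open>\<gamma> g\<close>.\<close>

lemma pr_pull_eq_iff_coset_invariant:
  assumes V: "V \<in> Ob (val D X0)" and V': "V' \<in> Ob (val D X0)"
    and f: "f \<in> arrows (val D U) (pull_ob D cover V) (pull_ob D cover V')"
  shows "pull_ar D (pr1 G cover) f = pull_ar D (pr2 G cover) f \<longleftrightarrow> coset_invariant f"
proof
  assume "pull_ar D (pr1 G cover) f = pull_ar D (pr2 G cover) f"
  then show "coset_invariant f"
    unfolding coset_invariant_def using pull_\<gamma>_pr_ar[OF _ f] by metis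
next
  assume inv: "coset_invariant f"
  have same: "pull_ob D (pr1 G cover) (pull_ob D cover Y) = pull_ob D (pr2 G cover) (pull_ob D cover Y)"
    if "Y \<in> Ob (val D X0)" for Y
    using pull_cover_eq[OF is_gmap_pr(1) _ is_gmap_pr(2) _ _ that] by simp
  have 1: "pull_ar D (pr1 G cover) f \<in> arrows (val D U2)
      (pull_ob D (pr1 G cover) (pull_ob D cover V)) (pull_ob D (pr1 G cover) (pull_ob D cover V'))"
    using pull_arrows[OF is_gmap_pr(1)] f by simp
  have 2: "pull_ar D (pr2 G cover) f \<in> arrows (val D U2)
      (pull_ob D (pr1 G cover) (pull_ob D cover V)) (pull_ob D (pr1 G cover) (pull_ob D cover V'))"
    using pull_arrows[OF is_gmap_pr(2)] f same[OF V] same[OF V'] by simp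
  show "pull_ar D (pr1 G cover) f = pull_ar D (pr2 G cover) f"
    by (rule arrows_eq_on_orbits[OF finite_gsets(3) orbit_cover_U2 1 2])
      (use inv in \<open>simp add: pull_\<gamma>_pr_ar[OF _ f] coset_invariant_def\<close>)
qed

abbreviation canonical :: "'o \<Rightarrow> 'o \<times> 'm" where
  "canonical V \<equiv> canonical_descent G D cover V"

lemma canonical_descent_object:
  assumes "V \<in> Ob (val D X0)"
  shows "canonical V \<in> descent_objects G D cover"
proof -
  have "is_functor (val D X0) (descent_cat G D cover) (descent_functor G D cover)"
    using descent unfolding equivalence_functor_def by blast
  from functor_Ob[OF this assms] show ?thesis
    unfolding descent_functor_def descent_cat_def by simp
qed

lemma descent_arrows_iff:
  "\<phi> \<in> arrows (descent_cat G D cover) (W, s) (W', s') \<longleftrightarrow>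
     (\<exists>f. \<phi> = ((W, s), (W', s'), f) \<and>
       (W, s) \<in> descent_objects G D cover \<and> (W', s') \<in> descent_objects G D cover \<and>
       f \<in> arrows (val D U) W W' \<and>
       pull_ar D (pr1 G cover) f \<cdot>\<^bsub>val D U2\<^esub> s = s' \<cdot>\<^bsub>val D U2\<^esub> pull_ar D (pr2 G cover) f)"
  by (auto simp: arrows_def descent_cat_def)

lemma descent_iso_is_iso:
  assumes "iso_arrow (descent_cat G D cover) (A, a) (B, b) \<phi>"
  obtains f where "\<phi> = ((A, a), (B, b), f)" "iso_arrow (val D U) A B f"
    "pull_ar D (pr1 G cover) f \<cdot>\<^bsub>val D U2\<^esub> a = b \<cdot>\<^bsub>val D U2\<^esub> pull_ar D (pr2 G cover) f"
proof -
  obtain \<psi> where \<psi>: "\<psi> \<in> arrows (descent_cat G D cover) (B, b) (A, a)"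
    "\<psi> \<cdot>\<^bsub>descent_cat G D cover\<^esub> \<phi> = Idn (descent_cat G D cover) (A, a)"
    "\<phi> \<cdot>\<^bsub>descent_cat G D cover\<^esub> \<psi> = Idn (descent_cat G D cover) (B, b)"
    using assms unfolding iso_arrow_def by blast
  obtain f where f: "\<phi> = ((A, a), (B, b), f)" "f \<in> arrows (val D U) A B"
    "pull_ar D (pr1 G cover) f \<cdot>\<^bsub>val D U2\<^esub> a = b \<cdot>\<^bsub>val D U2\<^esub> pull_ar D (pr2 G cover) f"
    using iso_arrowD[OF assms] unfolding descent_arrows_iff by blast
  obtain f' where f': "\<psi> = ((B, b), (A, a), f')" "f' \<in> arrows (val D U) B A"
    using \<psi>(1) unfolding descent_arrows_iff by blast
  have "iso_arrow (val D U) A B f"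
    using f f' \<psi>(2,3) unfolding iso_arrow_def descent_cat_def by auto
  then show thesis
    using that f by blast
qed

text \<open>The identity that serves as the canonical gluing isomorphism is written at \<open>pr\<^sub>2\<^sup>* \<alpha>\<^sup>* V\<close>, which is also
  \<open>pr\<^sub>1\<^sup>* \<alpha>\<^sup>* V\<close>; hence it can be composed with \<open>pr\<^sub>1\<^sup>* f\<close>.\<close>

lemma pr1_pull_canonical:
  assumes V: "V \<in> Ob (val D X0)"
    and f: "f \<in> arrows (val D U) (pull_ob D cover V) W"
  shows "pull_ar D (pr1 G cover) f \<cdot>\<^bsub>val D U2\<^esub>
    Idn (val D U2) (pull_ob D (pr2 G cover) (pull_ob D cover V)) = pull_ar D (pr1 G cover) f"
proof -
  have "pull_ob D (pr1 G cover) (pull_ob D cover V) = pull_ob D (pr2 G cover) (pull_ob D cover V)"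
    using pull_cover_eq[OF is_gmap_pr(1) _ is_gmap_pr(2) _ _ V] by simp
  moreover have "pull_ar D (pr1 G cover) f \<in>
      arrows (val D U2) (pull_ob D (pr1 G cover) (pull_ob D cover V)) (pull_ob D (pr1 G cover) W)"
    using pull_arrows[OF is_gmap_pr(1)] f by simp
  ultimately show ?thesis
    using comp_id_right[OF category_val[OF finite_gsets(3)]] by simp
qed

text \<open>Between canonical descent data both gluing isomorphisms are identities, so the condition on a morphism
  reduces to \<open>pr\<^sub>1\<^sup>* f = pr\<^sub>2\<^sup>* f\<close>.\<close>

lemma canonical_arrows:
  assumes V: "V \<in> Ob (val D X0)" and V': "V' \<in> Ob (val D X0)"
  shows "arrows (descent_cat G D cover) (canonical V) (canonical V') =
    (\<lambda>f. (canonical V, canonical V', f)) `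
      {f \<in> arrows (val D U) (pull_ob D cover V) (pull_ob D cover V'). coset_invariant f}"
proof -
  have right: "Idn (val D U2) (pull_ob D (pr2 G cover) (pull_ob D cover V')) \<cdot>\<^bsub>val D U2\<^esub>
      pull_ar D (pr2 G cover) f = pull_ar D (pr2 G cover) f"
    if "f \<in> arrows (val D U) (pull_ob D cover V) (pull_ob D cover V')" for f
    by (rule comp_id_left[OF category_val[OF finite_gsets(3)]
          pull_arrows[OF is_gmap_pr(2), unfolded projection_simps beta_gmap_simps, OF that]])
  note objects = canonical_descent_object[OF V] canonical_descent_object[OF V']
  show ?thesis
    using objects pr1_pull_canonical[OF V] right pr_pull_eq_iff_coset_invariant[OF V V']
    unfolding canonical_descent_def by (auto simp: descent_arrows_iff)
qed

lemma arrows_descend: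
  assumes V: "V \<in> Ob (val D X0)" and V': "V' \<in> Ob (val D X0)"
  shows "bij_betw (pull_ar D cover) (arrows (val D X0) V V')
    {f \<in> arrows (val D U) (pull_ob D cover V) (pull_ob D cover V'). coset_invariant f}"
proof -
  let ?S = "{f \<in> arrows (val D U) (pull_ob D cover V) (pull_ob D cover V'). coset_invariant f}"
  have "bij_betw (amap (descent_functor G D cover)) (arrows (val D X0) V V')
      ((\<lambda>f. (canonical V, canonical V', f)) ` ?S)"
    using equivalence_fully_faithful[OF descent V V'] canonical_arrows[OF V V']
    unfolding descent_functor_def by simp
  then have "bij_betw (\<lambda>f. (canonical V, canonical V', pull_ar D cover f)) (arrows (val D X0) V V')
      ((\<lambda>f. (canonical V, canonical V', f)) ` ?S)"
    by (rule bij_betw_cong[THEN iffD1, rotated])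
      (simp add: descent_functor_def arrows_def)
  moreover have "bij_betw (\<lambda>(x, y, f). f) ((\<lambda>f. (canonical V, canonical V', f)) ` ?S) ?S"
    by (rule bij_betw_byWitness[where f' = "\<lambda>f. (canonical V, canonical V', f)"]) auto
  ultimately show ?thesis
    using bij_betw_trans by (fastforce simp: comp_def)
qed

lemma beta_gmap_absorb:
  assumes "h \<in> H" and "g \<in> carrier G"
  shows "beta_gmap G K H (h \<otimes> g) = (beta_gmap G K H g :: ('g, 'a) gmap)"
proof -
  have "inv (h \<otimes> g) <# H = inv g <# H"
    using assms by (simp add: lcoset_eq_iff[OF H] group_normalize)
  then show ?thesis
    unfolding beta_gmap_def by simp
qed

lemma cap1_H: "h \<in> H \<Longrightarrow> cap1 G H h = H"
  using mem_cap1 subgroup.m_closed[OF H] subgroup.m_inv_closed[OF H] by auto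

lemma conj_H_iff:
  assumes h: "h \<in> H" and x: "x \<in> carrier G"
  shows "h \<otimes> x \<otimes> inv h \<in> H \<longleftrightarrow> x \<in> H"
proof
  assume "h \<otimes> x \<otimes> inv h \<in> H"
  then have "inv h \<otimes> (h \<otimes> x \<otimes> inv h) \<otimes> h \<in> H"
    using h subgroup.m_closed[OF H] subgroup.m_inv_closed[OF H] by blast
  then show "x \<in> H"
    using h x by (simp add: group_normalize)
qed (use h subgroup.m_closed[OF H] subgroup.m_inv_closed[OF H] in blast)

lemma cap_absorb:
  assumes h: "h \<in> H" and g: "g \<in> carrier G"
  shows "cap2 G H g h = cap1 G H (g \<otimes> h)" "cap1 G H (h \<otimes> g) = cap1 G H g"
    "cap2 G H h g = cap1 G H g"
proof -
  have *: "(h \<otimes> g) \<otimes> x \<otimes> inv (h \<otimes> g) \<in> H \<longleftrightarrow> g \<otimes> x \<otimes> inv g \<in> H" if x: "x \<in> H" for x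
  proof -
    have "(h \<otimes> g) \<otimes> x \<otimes> inv (h \<otimes> g) = h \<otimes> (g \<otimes> x \<otimes> inv g) \<otimes> inv h"
      using x h g by (simp add: group_normalize)
    then show ?thesis
      using conj_H_iff[OF h, of "g \<otimes> x \<otimes> inv g"] x g by simp
  qed
  show "cap2 G H g h = cap1 G H (g \<otimes> h)"
    using h g conj_H_iff[OF h] by (auto simp: mem_cap1 mem_cap2)
  show "cap1 G H (h \<otimes> g) = cap1 G H g" "cap2 G H h g = cap1 G H g"
    using h g * by (auto simp: mem_cap1 mem_cap2)
qed

end

locale coset_datum = coset_descent G D H
  for G :: "('g, 'z) monoid_scheme" (structure) and D :: "('g, 'a, 'o, 'm) presheaf" and H +
  fixes W s
  assumes datum: "coset_gluing_datum G D H W s"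
begin

lemma W_object: "W \<in> Ob (val D U)"
  using datum unfolding coset_gluing_datum_def by blast

lemma s_iso:
  "g \<in> carrier G \<Longrightarrow> iso_arrow (val D (coset_gset G (cap1 G H g)))
     (pull_ob D (\<beta>1 g \<one>) W) (pull_ob D (\<beta>1 g g) W) (s g)"
  using datum unfolding coset_gluing_datum_def by blast

lemmas s_arrows = iso_arrowD[OF s_iso]

lemma s_H: "h \<in> H \<Longrightarrow> s h = Idn (val D U) W"
  using datum unfolding coset_gluing_datum_def by blast

lemma s_cocycle:
  "g1 \<in> carrier G \<Longrightarrow> g2 \<in> carrier G \<Longrightarrow>
   pull_ar D (beta_gmap G (cap2 G H g2 g1) (cap1 G H (g2 \<otimes> g1)) \<one>) (s (g2 \<otimes> g1)) =
     pull_ar D (beta_gmap G (cap2 G H g2 g1) (cap1 G H g2) g1) (s g2)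
       \<cdot>\<^bsub>val D (coset_gset G (cap2 G H g2 g1))\<^esub>
     pull_ar D (beta_gmap G (cap2 G H g2 g1) (cap1 G H g1) \<one>) (s g1)"
  using datum unfolding coset_gluing_datum_def by blast

lemma pull_s_H:
  assumes a: "is_gmap G a" "Tgt a = U" and h: "h \<in> H"
  shows "pull_ar D a (s h) = Idn (val D (Src a)) (pull_ob D a W)"
  using functor_id[OF pull_functor[OF a(1)]] a(2) W_object s_H[OF h] by simp

lemma pull_s_one:
  assumes g: "g \<in> carrier G"
  shows "pull_ar D (beta_gmap G (cap1 G H g) (cap1 G H g) \<one>) (s g) = s g"
  unfolding beta_gmap_one[OF finite_carrier subgroup_cap1[OF g]]
  by (rule pull_id(2)[OF finite_gset_cap1[OF g] s_arrows[OF g]])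

text \<open>Condition (ii) for the pair \<open>(h, g)\<close>, in which \<open>H[h, g] = H[hg] = H[g]\<close> and \<open>s\<^sub>h\<close> is an identity.\<close>

lemma s_left_absorb:
  assumes h: "h \<in> H" and g: "g \<in> carrier G"
  shows "s (h \<otimes> g) = s g"
proof -
  let ?a = "beta_gmap G (cap1 G H g) H g :: ('g, 'a) gmap"
  have hg: "h \<otimes> g \<in> carrier G" using h g by simp
  have "s (h \<otimes> g) = pull_ar D ?a (s h) \<cdot>\<^bsub>val D (coset_gset G (cap1 G H g))\<^esub> s g"
    using s_cocycle[OF g, of h] h pull_s_one[OF g] pull_s_one[OF hg]
    unfolding cap_absorb[OF h g] cap1_H[OF h] by simp
  also have "\<dots> = s g"
    using pull_s_H[OF is_gmap_\<beta>1(1)[OF g] _ h]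
      comp_id_left[OF category_val[OF finite_gset_cap1[OF g]] s_arrows[OF g]] by simp
  finally show ?thesis .
qed

text \<open>Condition (ii) for the pair \<open>(g, u)\<close>, in which \<open>H[g, u] = H[gu]\<close> and \<open>s\<^sub>u\<close> is an identity.\<close>

lemma s_right_absorb:
  assumes u: "u \<in> H" and g: "g \<in> carrier G"
  shows "s (g \<otimes> u) = pull_ar D (beta_gmap G (cap1 G H (g \<otimes> u)) (cap1 G H g) u) (s g)"
proof -
  let ?K = "cap1 G H (g \<otimes> u)"
  let ?a = "beta_gmap G ?K (cap1 G H g) u :: ('g, 'a) gmap"
  have uG: "u \<in> carrier G" and gu: "g \<otimes> u \<in> carrier G" using u g by simp_all
  have into: "conjugates_into G u ?K (cap1 G H g)"
    using conjugates_into_cap1(2)[OF uG g] unfolding cap_absorb[OF u g] .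
  have a: "is_gmap G ?a"
    by (rule is_gmap_\<beta>[OF subgroup_cap1[OF gu] subgroup_cap1[OF g] uG into])
  \<comment> \<open>Right translation by \<open>u \<in> H\<close> is trivial on \<open>G/H\<close>, so \<open>\<beta>\<^sub>u\<close> and \<open>\<beta>\<^sub>1\<close> coincide as maps to \<open>U\<close>.\<close>
  have "comp_gmap (\<beta>1 g \<one>) ?a = beta_gmap G ?K H u"
    using comp_beta_gmap[OF finite_carrier subgroup_cap1[OF gu] subgroup_cap1[OF g] H uG into one_closed
        conjugates_into_H(2)[OF g]] uG by simp
  also have "\<dots> = \<beta>1 (g \<otimes> u) \<one>"
    using beta_gmap_absorb[OF u one_closed] uG by simp
  finally have "pull_ob D ?a (pull_ob D (\<beta>1 g \<one>) W) = pull_ob D (\<beta>1 (g \<otimes> u) \<one>) W"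
    using pull_comp_gmap(1)[OF a is_gmap_\<beta>1(2)[OF g]] W_object by simp
  then have as: "pull_ar D ?a (s g) \<in> arrows (val D (coset_gset G ?K))
      (pull_ob D (\<beta>1 (g \<otimes> u) \<one>) W) (pull_ob D ?a (pull_ob D (\<beta>1 g g) W))"
    using pull_arrows[OF a, unfolded beta_gmap_simps, OF s_arrows[OF g]] by simp
  have "s (g \<otimes> u) = pull_ar D ?a (s g) \<cdot>\<^bsub>val D (coset_gset G ?K)\<^esub> pull_ar D (\<beta>1 (g \<otimes> u) \<one>) (s u)"
    using s_cocycle[OF uG g] pull_s_one[OF gu] unfolding cap_absorb[OF u g] cap1_H[OF u] by simp
  also have "\<dots> = pull_ar D ?a (s g)"
    using pull_s_H[OF is_gmap_\<beta>1(2)[OF gu] _ u]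
      comp_id_right[OF category_val[OF finite_gset_cap1[OF gu]] as] by simp
  finally show ?thesis .
qed

lemma s_compatible:
  assumes g: "g \<in> carrier G" and g': "g' \<in> carrier G" and k: "is_gmap G k"
    and src: "Src k = Src (\<gamma> g)" and tgt: "Tgt k = Src (\<gamma> g')"
    and eq: "comp_gmap (\<gamma> g') k = \<gamma> g"
  shows "pull_ar D k (s g') = s g"
proof -
  obtain h u where h: "h \<in> H" and u: "u \<in> H" and geq: "g = h \<otimes> (g' \<otimes> u)"
    and k: "k = beta_gmap G (cap1 G H g) (cap1 G H g') u"
    by (rule \<gamma>_factorization[OF g g' k _ _ eq]) (use src tgt in simp_all)
  have g'u: "g' \<otimes> u \<in> carrier G" using g' u by simp
  have "cap1 G H g = cap1 G H (g' \<otimes> u)"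
    unfolding geq by (rule cap_absorb(2)[OF h g'u])
  then show ?thesis
    using s_right_absorb[OF u g'] s_left_absorb[OF h g'u] k geq by simp
qed

text \<open>The \<open>s\<^sub>g\<close> glue to an isomorphism \<open>\<sigma>\<close> over \<open>U\<^sup>2\<close>. Its cocycle condition holds because it holds on every orbit
  of \<open>U\<^sup>3\<close>, where it is condition (ii).\<close>

lemma descent_datum_exists:
  obtains \<sigma> where "(W, \<sigma>) \<in> descent_objects G D cover"
    "\<And>g. g \<in> carrier G \<Longrightarrow> pull_ar D (\<gamma> g) \<sigma> = s g"
proof -
  have Ob: "pull_ob D (pr1 G cover) W \<in> Ob (val D U2)" "pull_ob D (pr2 G cover) W \<in> Ob (val D U2)"
    using pull_Ob[OF is_gmap_pr(1)] pull_Ob[OF is_gmap_pr(2)] W_object by simp_all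
  have "\<exists>\<sigma>. iso_arrow (val D U2) (pull_ob D (pr2 G cover) W) (pull_ob D (pr1 G cover) W) \<sigma> \<and>
      (\<forall>g\<in>carrier G. pull_ar D (\<gamma> g) \<sigma> = s g)"
    by (rule glue_isos[OF finite_gsets(3) orbit_cover_U2 Ob(2,1)])
      (use s_iso s_compatible in \<open>simp_all add: pull_\<gamma>_pr_ob[OF _ W_object]\<close>)
  then obtain \<sigma> where \<sigma>: "iso_arrow (val D U2) (pull_ob D (pr2 G cover) W) (pull_ob D (pr1 G cover) W) \<sigma>"
    and \<sigma>s: "\<And>g. g \<in> carrier G \<Longrightarrow> pull_ar D (\<gamma> g) \<sigma> = s g"
    by blast
  note P = is_gmap_pr
  have pull_pr: "pull_ob D a (pull_ob D b W) = pull_ob D (comp_gmap b a) W"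
    if "is_gmap G a" "is_gmap G b" "Src b = Tgt a" "Tgt b = U" for a b
    using pull_comp_gmap(1)[OF that(1-3)] that(4) W_object by simp
  note \<sigma>13 = pull_arrows[OF P(4), unfolded projection_simps, OF iso_arrowD[OF \<sigma>]]
    and \<sigma>12 = pull_arrows[OF P(3), unfolded projection_simps, OF iso_arrowD[OF \<sigma>]]
    and \<sigma>23 = pull_arrows[OF P(5), unfolded projection_simps, OF iso_arrowD[OF \<sigma>]]
  define A B E where "A = pull_ob D (comp_gmap (pr2 G cover) (pr23 G cover)) W"
    and "B = pull_ob D (comp_gmap (pr2 G cover) (pr12 G cover)) W"
    and "E = pull_ob D (comp_gmap (pr1 G cover) (pr12 G cover)) W"
  have 13: "pull_ar D (pr13 G cover) \<sigma> \<in> arrows (val D U3) A E"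
    and 12: "pull_ar D (pr12 G cover) \<sigma> \<in> arrows (val D U3) B E"
    and 23: "pull_ar D (pr23 G cover) \<sigma> \<in> arrows (val D U3) A B"
    using \<sigma>13 \<sigma>12 \<sigma>23 P pr_pr[OF is_gmap_cover] unfolding A_def B_def E_def by (simp_all add: pull_pr)
  have "pull_ar D (pr13 G cover) \<sigma> = pull_ar D (pr12 G cover) \<sigma> \<cdot>\<^bsub>val D U3\<^esub> pull_ar D (pr23 G cover) \<sigma>"
  proof (rule arrows_eq_on_orbits[OF finite_gsets(4) orbit_cover_U3 13
        comp_arrows[OF category_val[OF finite_gsets(4)] 23 12]])
    fix l assume "l \<in> carrier G \<times> carrier G"
    then obtain g1 g2 where l: "l = (g2, g1)" and g: "g1 \<in> carrier G" "g2 \<in> carrier G"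
      by blast
    have g21: "g2 \<otimes> g1 \<in> carrier G" using g by simp
    note \<delta> = is_gmap_\<delta>[OF g]
    have restrict: "pull_ar D (\<delta> g2 g1) (pull_ar D b \<sigma>) = pull_ar D k (s g)"
      if b: "is_gmap G b" "Src b = U3" "Tgt b = U2" and k: "is_gmap G k" "Tgt k = Src (\<gamma> g)"
        and eq: "comp_gmap b (\<delta> g2 g1) = comp_gmap (\<gamma> g) k" and g: "g \<in> carrier G" for b k g
    proof -
      have "pull_ar D (\<delta> g2 g1) (pull_ar D b \<sigma>) = pull_ar D (comp_gmap b (\<delta> g2 g1)) \<sigma>"
        using pull_comp_gmap(2)[OF \<delta> b(1)] b iso_arrowD[OF \<sigma>] by simp
      also have "\<dots> = pull_ar D k (pull_ar D (\<gamma> g) \<sigma>)"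
        using pull_comp_gmap(2)[OF k(1) is_gmap_\<gamma>[OF g]] k iso_arrowD[OF \<sigma>] unfolding eq by simp
      finally show ?thesis
        using \<sigma>s[OF g] by simp
    qed
    note K = is_gmap_\<beta>[OF subgroup_cap2[OF g] subgroup_cap1]
    have "pull_ar D (\<delta> g2 g1) (pull_ar D (pr13 G cover) \<sigma>) =
        pull_ar D (beta_gmap G (cap2 G H g2 g1) (cap1 G H (g2 \<otimes> g1)) \<one>) (s (g2 \<otimes> g1))"
      by (rule restrict[OF P(4) _ _ K[OF g21 one_closed conjugates_into_cap1(1)[OF g]] _ pr_\<delta>(2)[OF g] g21])
        simp_all
    also have "\<dots> = pull_ar D (beta_gmap G (cap2 G H g2 g1) (cap1 G H g2) g1) (s g2)
       \<cdot>\<^bsub>val D (coset_gset G (cap2 G H g2 g1))\<^esub>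
     pull_ar D (beta_gmap G (cap2 G H g2 g1) (cap1 G H g1) \<one>) (s g1)"
      by (rule s_cocycle[OF g])
    also have "pull_ar D (beta_gmap G (cap2 G H g2 g1) (cap1 G H g2) g1) (s g2) =
        pull_ar D (\<delta> g2 g1) (pull_ar D (pr12 G cover) \<sigma>)"
      by (rule restrict[symmetric, OF P(3) _ _ K[OF g(2) g(1) conjugates_into_cap1(2)[OF g]] _ pr_\<delta>(1)[OF g] g(2)])
        simp_all
    also have "pull_ar D (beta_gmap G (cap2 G H g2 g1) (cap1 G H g1) \<one>) (s g1) =
        pull_ar D (\<delta> g2 g1) (pull_ar D (pr23 G cover) \<sigma>)"
      by (rule restrict[symmetric, OF P(5) _ _ K[OF g(1) one_closed conjugates_into_cap1(3)[OF g]] _ pr_\<delta>(3)[OF g] g(1)])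
        simp_all
    also have "pull_ar D (\<delta> g2 g1) (pull_ar D (pr12 G cover) \<sigma>)
        \<cdot>\<^bsub>val D (coset_gset G (cap2 G H g2 g1))\<^esub> pull_ar D (\<delta> g2 g1) (pull_ar D (pr23 G cover) \<sigma>) =
      pull_ar D (\<delta> g2 g1) (pull_ar D (pr12 G cover) \<sigma> \<cdot>\<^bsub>val D U3\<^esub> pull_ar D (pr23 G cover) \<sigma>)"
      using pull_cmp[OF \<delta>, unfolded tuple_gmap_simps beta_gmap_simps, OF 23 12] by simp
    finally show "pull_ar D (case l of (g2, g1) \<Rightarrow> \<delta> g2 g1) (pull_ar D (pr13 G cover) \<sigma>) =
        pull_ar D (case l of (g2, g1) \<Rightarrow> \<delta> g2 g1)
          (pull_ar D (pr12 G cover) \<sigma> \<cdot>\<^bsub>val D U3\<^esub> pull_ar D (pr23 G cover) \<sigma>)"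
      unfolding l by simp
  qed
  then have "(W, \<sigma>) \<in> descent_objects G D cover"
    using W_object \<sigma> unfolding descent_objects_def by simp
  then show thesis
    using that \<sigma>s by blast
qed

lemma gluing_exists: "\<exists>V f. coset_gluing G D H W s V f"
proof -
  obtain \<sigma> where desc: "(W, \<sigma>) \<in> descent_objects G D cover"
    and \<sigma>s: "\<And>g. g \<in> carrier G \<Longrightarrow> pull_ar D (\<gamma> g) \<sigma> = s g"
    by (rule descent_datum_exists) blast
  have \<sigma>: "\<sigma> \<in> arrows (val D U2) (pull_ob D (pr2 G cover) W) (pull_ob D (pr1 G cover) W)"
    using desc unfolding descent_objects_def by (auto intro: iso_arrowD)
  have "(W, \<sigma>) \<in> Ob (descent_cat G D cover)"
    using desc unfolding descent_cat_def by simp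
  from equivalence_essentially_surjective[OF descent this]
  obtain V \<phi> where V: "V \<in> Ob (val D X0)"
    and \<phi>: "iso_arrow (descent_cat G D cover) (canonical V) (W, \<sigma>) \<phi>"
    unfolding descent_functor_def ftor.select_convs by blast
  obtain f where f: "iso_arrow (val D U) (pull_ob D cover V) W f"
    and eq: "pull_ar D (pr1 G cover) f \<cdot>\<^bsub>val D U2\<^esub>
        Idn (val D U2) (pull_ob D (pr2 G cover) (pull_ob D cover V)) =
      \<sigma> \<cdot>\<^bsub>val D U2\<^esub> pull_ar D (pr2 G cover) f"
    by (rule descent_iso_is_iso[OF \<phi>[unfolded canonical_descent_def]]) blast
  note fa = iso_arrowD[OF f]
  have eq': "pull_ar D (pr1 G cover) f = \<sigma> \<cdot>\<^bsub>val D U2\<^esub> pull_ar D (pr2 G cover) f"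
    using eq pr1_pull_canonical[OF V fa] by simp
  have 2: "pull_ar D (pr2 G cover) f \<in> arrows (val D U2)
      (pull_ob D (pr2 G cover) (pull_ob D cover V)) (pull_ob D (pr2 G cover) W)"
    using pull_arrows[OF is_gmap_pr(2), unfolded projection_simps beta_gmap_simps, OF fa] .
  have "pull_ar D (\<beta>1 g g) f =
      s g \<cdot>\<^bsub>val D (coset_gset G (cap1 G H g))\<^esub> pull_ar D (\<beta>1 g \<one>) f" if g: "g \<in> carrier G" for g
    using pull_cmp[OF is_gmap_\<gamma>[OF g], unfolded tuple_gmap_simps beta_gmap_simps, OF 2 \<sigma>]
      pull_\<gamma>_pr_ar[OF g fa] \<sigma>s[OF g] eq' by simp
  then show ?thesis
    using V f unfolding coset_gluing_def by blast
qed

text \<open>The equation determines \<open>\<alpha>\<^sup>* i = f'\<^sup>-\<^sup>1 f\<close>. From \<open>\<beta>\<^sub>g\<^sup>* f = s\<^sub>g \<circ> \<beta>\<^sub>1\<^sup>* f\<close> and the same equation for \<open>f'\<close>, the \<open>s\<^sub>g\<close>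
  cancel, so \<open>f'\<^sup>-\<^sup>1 f\<close> has equal pullbacks along \<open>\<beta>\<^sub>1\<close> and \<open>\<beta>\<^sub>g\<close> and descends.\<close>

lemma gluing_morphism_unique_exists:
  assumes g1: "coset_gluing G D H W s V f" and g2: "coset_gluing G D H W s V' f'"
  shows "\<exists>!i. i \<in> arrows (val D X0) V V' \<and> f' \<cdot>\<^bsub>val D U\<^esub> pull_ar D cover i = f"
proof -
  have V: "V \<in> Ob (val D X0)" and f: "iso_arrow (val D U) (pull_ob D cover V) W f"
    and fg: "\<And>g. g \<in> carrier G \<Longrightarrow> pull_ar D (\<beta>1 g g) f =
      s g \<cdot>\<^bsub>val D (coset_gset G (cap1 G H g))\<^esub> pull_ar D (\<beta>1 g \<one>) f"
    using g1 unfolding coset_gluing_def by auto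
  have V': "V' \<in> Ob (val D X0)" and f': "iso_arrow (val D U) (pull_ob D cover V') W f'"
    and f'g: "\<And>g. g \<in> carrier G \<Longrightarrow> pull_ar D (\<beta>1 g g) f' =
      s g \<cdot>\<^bsub>val D (coset_gset G (cap1 G H g))\<^esub> pull_ar D (\<beta>1 g \<one>) f'"
    using g2 unfolding coset_gluing_def by auto
  note C = category_val[OF finite_gsets(2)] and fa = iso_arrowD[OF f] and f'a = iso_arrowD[OF f']
  obtain e where e: "iso_arrow (val D U) W (pull_ob D cover V') e" "f' \<cdot>\<^bsub>val D U\<^esub> e = Idn (val D U) W"
    using f' by (rule iso_arrow_inverseE)
  define \<phi> where "\<phi> = e \<cdot>\<^bsub>val D U\<^esub> f"
  have \<phi>: "\<phi> \<in> arrows (val D U) (pull_ob D cover V) (pull_ob D cover V')"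
    unfolding \<phi>_def by (rule comp_arrows[OF C fa iso_arrowD[OF e(1)]])
  have f'\<phi>: "f' \<cdot>\<^bsub>val D U\<^esub> \<phi> = f"
    unfolding \<phi>_def comp_assoc[OF C fa iso_arrowD[OF e(1)] f'a, symmetric] e(2)
    by (rule comp_id_left[OF C fa])
  have "pull_ar D (\<beta>1 g \<one>) \<phi> = pull_ar D (\<beta>1 g g) \<phi>" if g: "g \<in> carrier G" for g
  proof -
    let ?C = "val D (coset_gset G (cap1 G H g))"
    note b1 = is_gmap_\<beta>1(2)[OF g] and bg = is_gmap_\<beta>1(1)[OF g]
    note cat = category_val[OF finite_gset_cap1[OF g]]
    have same: "pull_ob D (\<beta>1 g \<one>) (pull_ob D cover Y) = pull_ob D (\<beta>1 g g) (pull_ob D cover Y)"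
      if "Y \<in> Ob (val D X0)" for Y
      using pull_cover_eq[OF b1 _ bg _ _ that] by simp
    note \<phi>1 = pull_arrows[OF b1, unfolded beta_gmap_simps, OF \<phi>]
      and \<phi>g = pull_arrows[OF bg, unfolded beta_gmap_simps, OF \<phi>]
      and f'1 = pull_arrows[OF b1, unfolded beta_gmap_simps, OF f'a]
      and f'g_iso = pull_iso[OF bg, unfolded beta_gmap_simps, OF f']
    have "pull_ar D (\<beta>1 g g) f' \<cdot>\<^bsub>?C\<^esub> pull_ar D (\<beta>1 g g) \<phi> = pull_ar D (\<beta>1 g g) f"
      using pull_cmp[OF bg, unfolded beta_gmap_simps, OF \<phi> f'a] f'\<phi> by simp
    also have "\<dots> = s g \<cdot>\<^bsub>?C\<^esub> pull_ar D (\<beta>1 g \<one>) f"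
      by (rule fg[OF g])
    also have "\<dots> = s g \<cdot>\<^bsub>?C\<^esub> (pull_ar D (\<beta>1 g \<one>) f' \<cdot>\<^bsub>?C\<^esub> pull_ar D (\<beta>1 g \<one>) \<phi>)"
      using pull_cmp[OF b1, unfolded beta_gmap_simps, OF \<phi> f'a] f'\<phi> by simp
    also have "\<dots> = pull_ar D (\<beta>1 g g) f' \<cdot>\<^bsub>?C\<^esub> pull_ar D (\<beta>1 g \<one>) \<phi>"
      unfolding f'g[OF g] by (rule comp_assoc[OF cat \<phi>1 f'1 s_arrows[OF g], symmetric])
    finally show ?thesis
      using iso_cancel_left[OF cat f'g_iso \<phi>g] \<phi>1 unfolding same[OF V] same[OF V'] by simp
  qed
  then have inv: "coset_invariant \<phi>"
    unfolding coset_invariant_def by blast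
  have "\<exists>!i. i \<in> arrows (val D X0) V V' \<and> pull_ar D cover i = \<phi>"
    using bij_betw_ex1[OF arrows_descend[OF V V']] \<phi> inv by simp
  moreover have "(i \<in> arrows (val D X0) V V' \<and> f' \<cdot>\<^bsub>val D U\<^esub> pull_ar D cover i = f) =
      (i \<in> arrows (val D X0) V V' \<and> pull_ar D cover i = \<phi>)" for i
    using iso_cancel_left[OF C f' pull_arrows[OF is_gmap_cover, unfolded beta_gmap_simps, of i V V'] \<phi>]
      f'\<phi> by auto
  ultimately show ?thesis
    by presburger
qed

text \<open>The arrows between two solutions in either direction are mutually inverse, since both composites and the
  identities solve the same unique existence problem.\<close>

lemma gluing_unique:
  assumes g1: "coset_gluing G D H W s V f" and g2: "coset_gluing G D H W s V' f'"
  shows "\<exists>!i. iso_arrow (val D X0) V V' i \<and> f' \<cdot>\<^bsub>val D U\<^esub> pull_ar D cover i = f"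
proof -
  note C0 = category_val[OF finite_gsets(1)] and C = category_val[OF finite_gsets(2)]
  have unique: "i = i'"
    if "coset_gluing G D H W s V f" "coset_gluing G D H W s V' f'"
      and "i \<in> arrows (val D X0) V V'" "i' \<in> arrows (val D X0) V V'"
      and "f' \<cdot>\<^bsub>val D U\<^esub> pull_ar D cover i = f" "f' \<cdot>\<^bsub>val D U\<^esub> pull_ar D cover i' = f"
    for V V' f f' i i'
    using the1_equality[OF gluing_morphism_unique_exists[OF that(1,2)], OF conjI[OF that(3,5)]]
      the1_equality[OF gluing_morphism_unique_exists[OF that(1,2)], OF conjI[OF that(4,6)]]
    by simp
  have endo: "j \<cdot>\<^bsub>val D X0\<^esub> i = Idn (val D X0) V"
    if g1: "coset_gluing G D H W s V f"
      and i: "i \<in> arrows (val D X0) V V'" "f' \<cdot>\<^bsub>val D U\<^esub> pull_ar D cover i = f"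
      and j: "j \<in> arrows (val D X0) V' V" "f \<cdot>\<^bsub>val D U\<^esub> pull_ar D cover j = f'" for V V' f f' i j
  proof -
    have V: "V \<in> Ob (val D X0)" and f: "f \<in> arrows (val D U) (pull_ob D cover V) W"
      using g1 iso_arrowD unfolding coset_gluing_def by auto
    note pi = pull_arrows[OF is_gmap_cover, unfolded beta_gmap_simps, OF i(1)]
      and pj = pull_arrows[OF is_gmap_cover, unfolded beta_gmap_simps, OF j(1)]
    have "f \<cdot>\<^bsub>val D U\<^esub> pull_ar D cover (j \<cdot>\<^bsub>val D X0\<^esub> i) =
        (f \<cdot>\<^bsub>val D U\<^esub> pull_ar D cover j) \<cdot>\<^bsub>val D U\<^esub> pull_ar D cover i"
      using pull_cmp[OF is_gmap_cover, unfolded beta_gmap_simps, OF i(1) j(1)]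
        comp_assoc[OF C pi pj f] by simp
    then have "f \<cdot>\<^bsub>val D U\<^esub> pull_ar D cover (j \<cdot>\<^bsub>val D X0\<^esub> i) = f"
      using i j by simp
    moreover have "f \<cdot>\<^bsub>val D U\<^esub> pull_ar D cover (Idn (val D X0) V) = f"
      using functor_id[OF pull_functor[OF is_gmap_cover], unfolded beta_gmap_simps, OF V]
        comp_id_right[OF C f] by simp
    ultimately show ?thesis
      by (rule unique[OF g1 g1 comp_arrows[OF C0 i(1) j(1)] id_arrows[OF C0 V]])
  qed
  obtain i where i: "i \<in> arrows (val D X0) V V'" "f' \<cdot>\<^bsub>val D U\<^esub> pull_ar D cover i = f"
    using ex1_implies_ex[OF gluing_morphism_unique_exists[OF g1 g2]] by blast
  obtain j where j: "j \<in> arrows (val D X0) V' V" "f \<cdot>\<^bsub>val D U\<^esub> pull_ar D cover j = f'"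
    using ex1_implies_ex[OF gluing_morphism_unique_exists[OF g2 g1]] by blast
  have "iso_arrow (val D X0) V V' i"
    unfolding iso_arrow_def using i(1) j(1) endo[OF g1 i j] endo[OF g2 j i] by blast
  then show ?thesis
    using i unique[OF g1 g2] iso_arrowD[of "val D X0" V V'] by (intro ex1I[of _ i]) auto
qed

end

section \<open>Gluing over a subgroup of index prime to p\<close>

theorem theorem8p6:
  fixes G :: "('g, 'z) monoid_scheme" and p :: nat
    and D :: "('g, 'a, 'o, 'm) presheaf" and H :: "'g set"
  defines "X0 \<equiv> coset_gset G (carrier G)"
    and "U \<equiv> coset_gset G H"
    and "\<alpha> \<equiv> beta_gmap G H (carrier G) \<one>\<^bsub>G\<^esub>"
  assumes "group G" and "finite (carrier G)" and "prime p"
    and "strict_sipp_stack G p D" and "respects_disjoint_unions G D"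
    and "subgroup H G" and "coprime (sub_index G (carrier G) H) p"
  shows
    "(\<forall>V\<in>Ob (val D X0). \<forall>V'\<in>Ob (val D X0).
        bij_betw (pull_ar D \<alpha>)
          (arrows (val D X0) V V')
          {f \<in> arrows (val D U) (pull_ob D \<alpha> V) (pull_ob D \<alpha> V').
             \<forall>g\<in>carrier G. pull_ar D (beta_gmap G (cap1 G H g) H \<one>\<^bsub>G\<^esub>) f =
                            pull_ar D (beta_gmap G (cap1 G H g) H g) f}) \<and>
     (\<forall>W s. coset_gluing_datum G D H W s \<longrightarrow>
        (\<exists>V f. coset_gluing G D H W s V f) \<and>
        (\<forall>V f V' f'. coset_gluing G D H W s V f \<longrightarrow> coset_gluing G D H W s V' f' \<longrightarrow>
           (\<exists>!i. iso_arrow (val D X0) V V' i \<and>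
                  f' \<cdot>\<^bsub>val D U\<^esub> pull_ar D \<alpha> i = f)))"
proof -
  interpret group G by fact
  interpret H: subgroup H G by fact
  have "strict_presheaf G D"
    using \<open>strict_sipp_stack G p D\<close> unfolding strict_sipp_stack_def by blast
  moreover have "equivalence_functor (val D (coset_gset G (carrier G)))
      (descent_cat G D (beta_gmap G H (carrier G) \<one>\<^bsub>G\<^esub>))
      (descent_functor G D (beta_gmap G H (carrier G) \<one>\<^bsub>G\<^esub>))"
    using \<open>strict_sipp_stack G p D\<close> sipp_cover_coset[of H p] assms(5,9,10)
    unfolding strict_sipp_stack_def by force
  ultimately interpret coset_descent G D H
    using assms by unfold_locales
  have "coset_datum G D H W s" if "coset_gluing_datum G D H W s" for W s
    using that by unfold_locales
  note datum = coset_datum.gluing_exists[OF this] coset_datum.gluing_unique[OF this]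
  show ?thesis
    unfolding X0_def U_def \<alpha>_def
    by (intro conjI ballI allI impI arrows_descend[unfolded coset_invariant_def] datum)
qed

end
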